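(* There exist universal constants $C,C'>0$ such that the following holds in the Bradley-Terry-Luce model described in the context, for any fixed $0<\delta<0.5$. Let $G=(V,E)$ be the 1D grid or the 2D grid with $n$ nodes, radius $r$ and edge probability $p=1$, and let $L_{i,j}=L$ for all $(i,j)\in E$. If $$rL\ge C\,\kappa_E^5\,n\log(n/\delta)\ \text{ (1D grid)},\qquad\text{resp.}\qquad r^2L\ge C\,\kappa_E^5\,n\log(n/\delta)\ \text{ (2D grid)},$$ then with probability at least $1-\delta$ (over the samples) the optimization problem $\min_{\theta\in\mathbb R^n:\ \theta^\top1_n=0}\mathcal L(\theta)$ admits a unique and finite minimizer $\theta^{\mathsf{MLE}}$, which satisfies for all $1\le k<\ell\le n$ $$\big|(\theta^{\mathsf{MLE}}_k-\theta^{\mathsf{MLE}}_\ell)-(\theta^\star_k-\theta^\star_\ell)\big|\le\begin{cases}C'\kappa_E\sqrt{\big(\frac n{r^2}+1\big)\frac1{rL}\log\big(\frac n\delta\big)} & \text{for the 1D grid},\\[4pt] C'\kappa_E\sqrt{\big(\frac{\log n}{r^2}+1\big)\frac1{r^2L}\log\big(\frac n\delta\big)} & \text{for the 2D grid}.\end{cases}$$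
   Context: Grids (with edge probability $p=1$). The 1D grid with $n$ nodes and radius $r$ has nodes $\{1,\dots,n\}$, with distinct $i,j$ joined by an edge iff $|i-j|\le r$. The 2D grid with $n$ nodes and radius $r$ has nodes indexed by $\{(i_1,i_2):1\le i_1,i_2\le\sqrt n\}$ (so $n$ is a perfect square), with distinct $(i_1,i_2),(j_1,j_2)$ joined by an edge iff $|i_1-j_1|+|i_2-j_2|\le r$ (the nodes are also enumerated as $1,\dots,n$ in an arbitrary fixed order). Model. $G=(V,E)$ is a connected undirected graph with $n$ nodes. The ground-truth score vector $\theta^\star\in\mathbb R^n$ satisfies $\sum_i\theta^\star_i=0$, and there are finite numbers $\kappa\ge\kappa_E\ge1$ with $\max_{1\le i<j\le n}|\theta^\star_i-\theta^\star_j|\le\log\kappa$ and $\max_{(i,j)\in E}|\theta^\star_i-\theta^\star_j|\le\log\kappa_E$. Let $\sigma(x)=1/(1+e^{-x})$. For each edge $(i,j)\in E$ with $i<j$ there are $L_{i,j}$ samples $y_{i,j}^{(1)},\dots,y_{i,j}^{(L_{i,j})}\in\{0,1\}$; all samples are independent and $\Pr(y_{i,j}^{(\ell)}=1)=1-\Pr(y_{i,j}^{(\ell)}=0)=\sigma(\theta^\star_i-\theta^\star_j)$. Negative log-likelihood: $$\mathcal L(\theta)=\sum_{(i,j)\in E,\,i<j}\ \sum_{1\le\ell\le L_{i,j}}\Big(-y_{i,j}^{(\ell)}(\theta_i-\theta_j)+\log(1+e^{\theta_i-\theta_j})\Big).$$ $1_n$ is the all-one vector in $\mathbb R^n$.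
   Formalization: The radius is assumed to satisfy r ≤ n (1D grid), resp. r ≤ 2√n (2D grid); without an upper bound on r the claim fails (1D, n = 2, L = 1, r huge: no minimizer exists), and no grid graph is lost. *)

theory Defs
  imports "HOL-Probability.Probability" "HOL-Probability.Product_PMF"
begin

text \<open>Graphs live on the vertex set \<open>{1..n}\<close>; an undirected edge set is a symmetric relation,
  and each edge is counted once by selecting its representative \<open>(i, j)\<close> with \<open>i < j\<close>.\<close>

definition connected_graph :: "nat \<Rightarrow> (nat \<times> nat) set \<Rightarrow> bool" where
  "connected_graph n E \<longleftrightarrow>
     1 \<le> n \<and> E \<subseteq> {1..n} \<times> {1..n} \<and> sym E \<and> irrefl E \<and>
     (\<forall>i\<in>{1..n}. \<forall>j\<in>{1..n}. (i, j) \<in> E\<^sup>*)"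

definition grid_1d :: "nat \<Rightarrow> real \<Rightarrow> (nat \<times> nat) set" where
  "grid_1d n r =
     {(i, j). i \<in> {1..n} \<and> j \<in> {1..n} \<and> i \<noteq> j \<and> \<bar>real i - real j\<bar> \<le> r}"

text \<open>The function \<open>pos\<close> maps the number of a node to its position in the square; it is intended to
  satisfy \<open>grid_enumeration\<close>, which fixes an arbitrary order of the nodes.\<close>

definition grid_enumeration :: "nat \<Rightarrow> (nat \<Rightarrow> nat \<times> nat) \<Rightarrow> bool" where
  "grid_enumeration n pos \<longleftrightarrow> (\<exists>m. n = m\<^sup>2 \<and> bij_betw pos {1..n} ({1..m} \<times> {1..m}))"

definition grid_2d :: "nat \<Rightarrow> (nat \<Rightarrow> nat \<times> nat) \<Rightarrow> real \<Rightarrow> (nat \<times> nat) set" where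
  "grid_2d n pos r =
     {(i, j). i \<in> {1..n} \<and> j \<in> {1..n} \<and> i \<noteq> j \<and>
        \<bar>real (fst (pos i)) - real (fst (pos j))\<bar> + \<bar>real (snd (pos i)) - real (snd (pos j))\<bar> \<le> r}"

text \<open>Vectors in \<open>\<real>\<close>-to-the-\<open>n\<close> are extensional functions on \<open>{1..n}\<close>, so that
  equality of functions is equality of vectors and uniqueness of a minimizer can be stated
  literally.\<close>

definition centered_vectors :: "nat \<Rightarrow> (nat \<Rightarrow> real) set" where
  "centered_vectors n = {\<theta> \<in> {1..n} \<rightarrow>\<^sub>E UNIV. (\<Sum>i=1..n. \<theta> i) = 0}"

definition btl_model :: "nat \<Rightarrow> (nat \<times> nat) set \<Rightarrow> (nat \<Rightarrow> real) \<Rightarrow> real \<Rightarrow> real \<Rightarrow> bool" where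
  "btl_model n E \<theta>s \<kappa> \<kappa>E \<longleftrightarrow>
     connected_graph n E \<and> \<theta>s \<in> centered_vectors n \<and> 1 \<le> \<kappa>E \<and> \<kappa>E \<le> \<kappa> \<and>
     (\<forall>i j. 1 \<le> i \<and> i < j \<and> j \<le> n \<longrightarrow> \<bar>\<theta>s i - \<theta>s j\<bar> \<le> ln \<kappa>) \<and>
     (\<forall>(i, j)\<in>E. \<bar>\<theta>s i - \<theta>s j\<bar> \<le> ln \<kappa>E)"

definition logistic :: "real \<Rightarrow> real" where
  "logistic x = 1 / (1 + exp (- x))"

definition sample_indices :: "(nat \<times> nat) set \<Rightarrow> (nat \<Rightarrow> nat \<Rightarrow> nat) \<Rightarrow> (nat \<times> nat \<times> nat) set" where
  "sample_indices E L = {(i, j, l). (i, j) \<in> E \<and> i < j \<and> 1 \<le> l \<and> l \<le> L i j}"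

text \<open>The joint law of the independent samples; \<open>True\<close> encodes the outcome 1. Coordinates
  outside the index set are constantly \<open>False\<close> and are never read by the likelihood. Working with
  the law of the samples instead of an arbitrary probability space keeps the constants in a
  statement about it independent of the choice of (the type of) a sample space.\<close>

definition btl_samples ::
    "(nat \<times> nat) set \<Rightarrow> (nat \<Rightarrow> nat \<Rightarrow> nat) \<Rightarrow> (nat \<Rightarrow> real) \<Rightarrow> (nat \<times> nat \<times> nat \<Rightarrow> bool) pmf" where
  "btl_samples E L \<theta>s =
     Pi_pmf (sample_indices E L) False (\<lambda>(i, j, l). bernoulli_pmf (logistic (\<theta>s i - \<theta>s j)))"

definition neg_log_likelihood ::
    "(nat \<times> nat) set \<Rightarrow> (nat \<Rightarrow> nat \<Rightarrow> nat) \<Rightarrow> (nat \<times> nat \<times> nat \<Rightarrow> bool) \<Rightarrow> (nat \<Rightarrow> real) \<Rightarrow> real" where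
  "neg_log_likelihood E L y \<theta> =
     (\<Sum>(i, j)\<in>{(i, j). (i, j) \<in> E \<and> i < j}. \<Sum>l=1..L i j.
        - of_bool (y (i, j, l)) * (\<theta> i - \<theta> j) + ln (1 + exp (\<theta> i - \<theta> j)))"

definition is_mle ::
    "nat \<Rightarrow> (nat \<times> nat) set \<Rightarrow> (nat \<Rightarrow> nat \<Rightarrow> nat) \<Rightarrow> (nat \<times> nat \<times> nat \<Rightarrow> bool) \<Rightarrow> (nat \<Rightarrow> real) \<Rightarrow> bool" where
  "is_mle n E L y \<theta> \<longleftrightarrow>
     is_arg_min (neg_log_likelihood E L y) (\<lambda>\<theta>. \<theta> \<in> centered_vectors n) \<theta>"

definition mle_error_le ::
    "nat \<Rightarrow> (nat \<times> nat) set \<Rightarrow> (nat \<Rightarrow> nat \<Rightarrow> nat) \<Rightarrow> (nat \<Rightarrow> real) \<Rightarrow> real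
     \<Rightarrow> (nat \<times> nat \<times> nat \<Rightarrow> bool) \<Rightarrow> bool" where
  "mle_error_le n E L \<theta>s B y \<longleftrightarrow>
     (\<exists>!\<theta>. is_mle n E L y \<theta>) \<and>
     (\<forall>\<theta>. is_mle n E L y \<theta> \<longrightarrow>
        (\<forall>k l. 1 \<le> k \<and> k < l \<and> l \<le> n \<longrightarrow> \<bar>(\<theta> k - \<theta> l) - (\<theta>s k - \<theta>s l)\<bar> \<le> B))"

end

theory Submission
  imports Defs
begin

text \<open>Let \<open>H\<close> be the Hessian of the likelihood at the true scores and let \<open>u\<close> solve
  \<open>H u = e\<^sub>k - e\<^sub>l\<close>. The energy of \<open>u\<close> is controlled by the effective resistance between \<open>k\<close> and \<open>l\<close>, so
  Hoeffding's inequality bounds the noise term \<open><u, gradient>\<close>, and the Cauchy--Schwarz inequality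
  bounds the second-order remainder by the sum of \<open>|u\<^sub>i - u\<^sub>j|\<close> over the edges times the squared
  maximal error along an edge. If the sample size is large enough to make the remainder dominated by
  the noise, a Newton step maps a small box around the true scores into itself, and the minimizer of
  the likelihood over that box is a critical point, hence the unique global minimizer.
  It remains to bound the effective resistances of the grids: averaging over blocks of side
  proportional to \<open>r\<close> reduces them to those of a path or a square lattice. In the lattice, two points of
  a row are joined through triangles whose column averages vary slowly, which gives the logarithm.\<close>

section \<open>The logistic function\<close>

text \<open>Existence cannot be presupposed: for unlucky samples the likelihood has no finite
  minimizer, so the estimator is constructed near the true scores. The box constrains only
  differences along edges, as only these enter the likelihood. Let Q bound the resistance of every
  edge, R that of the pair k, l, and let \<tau> = ln (n / \<delta>). The noise along an edge is of
  order \<kappa>E sqrt (Q \<tau> / L). Its square, summed against the potential, costs \<kappa>E^3 Q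
  (\<tau> / L) sqrt (|E| R), to be compared with the noise \<kappa>E sqrt (R \<tau> / L) of the
  pair. Here R cancels, which leaves \<kappa>E^4 Q^2 |E| \<tau> \<le> L up to a constant. So the
  sample size is governed by local quantities: Q and |E| are at most of order 1/r and n r in
  dimension one, 1/r^2 and n r^2 in dimension two, which gives n/r and n/r^2. The global resistance
  R appears in the error bound only.\<close>

lemma logistic_bounds: "0 < logistic x" "logistic x < 1"
  by (auto simp: logistic_def add_pos_pos)

lemma one_minus_logistic: "1 - logistic x = exp (- x) / (1 + exp (- x))"
proof -
  have "1 + exp (- x) > 0" by (simp add: add_pos_pos)
  then show ?thesis by (simp add: logistic_def field_simps)
qed

lemma has_real_derivative_logistic:
  "(logistic has_real_derivative logistic x * (1 - logistic x)) (at x)"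
proof -
  have pos: "1 + exp (- x) > 0" by (simp add: add_pos_pos)
  have "((\<lambda>x. 1 / (1 + exp (- x))) has_real_derivative
          exp (- x) / ((1 + exp (- x)) * (1 + exp (- x)))) (at x)"
    using pos by (auto intro!: derivative_eq_intros)
  moreover have "exp (- x) / ((1 + exp (- x)) * (1 + exp (- x))) = logistic x * (1 - logistic x)"
    unfolding one_minus_logistic by (simp add: logistic_def)
  ultimately show ?thesis
    by (simp add: logistic_def[abs_def])
qed

lemma has_real_derivative_softplus:
  "((\<lambda>x. ln (1 + exp x)) has_real_derivative logistic x) (at x)"
proof -
  have pos: "1 + exp x > 0" by (simp add: add_pos_pos)
  have "((\<lambda>x. ln (1 + exp x)) has_real_derivative exp x / (1 + exp x)) (at x)"
    using pos by (auto intro!: derivative_eq_intros)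
  moreover have "exp x / (1 + exp x) = logistic x"
    using pos by (simp add: logistic_def exp_minus field_simps)
  ultimately show ?thesis by simp
qed

lemma logistic_strict_mono: "x < y \<Longrightarrow> logistic x < logistic y"
  by (simp add: logistic_def divide_strict_left_mono add_pos_pos)

text \<open>With t = exp (-x) the slope is t / (1 + t)^2, where t lies between 1/\<kappa> and
  \<kappa>, and 1 + t is at most twice the larger of 1 and t. In this way the range of the scores
  along edges enters the curvature.\<close>

lemma logistic_slope_ge:
  assumes "1 \<le> \<kappa>" "\<bar>x\<bar> \<le> ln \<kappa>"
  shows "1 / (4 * \<kappa>) \<le> logistic x * (1 - logistic x)"
proof -
  define t where "t = exp (- x)"
  have t: "0 < t" by (simp add: t_def)
  have "t \<le> exp (ln \<kappa>)" unfolding t_def exp_le_cancel_iff using assms by linarith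
  then have t2: "t \<le> \<kappa>" using assms by simp
  have "exp (- ln \<kappa>) \<le> t" unfolding t_def exp_le_cancel_iff using assms by linarith
  then have t1: "1 \<le> \<kappa> * t" using assms by (simp add: exp_minus field_simps)
  have "(1 + t)\<^sup>2 \<le> 4 * \<kappa> * t"
  proof (cases "t \<le> 1")
    case True
    then have "(1 + t)\<^sup>2 \<le> 2\<^sup>2" using t by (intro power_mono) auto
    then show ?thesis using t1 by simp
  next
    case False
    then have "(1 + t)\<^sup>2 \<le> (2 * t)\<^sup>2" using t by (intro power_mono) auto
    also have "\<dots> = 4 * t * t" by (simp add: power2_eq_square)
    also have "\<dots> \<le> 4 * \<kappa> * t" using t t2 by (intro mult_right_mono) auto
    finally show ?thesis .
  qed
  then have "1 / (4 * \<kappa>) \<le> t / (1 + t)\<^sup>2"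
    using t assms by (simp add: field_simps)
  also have "\<dots> = logistic x * (1 - logistic x)"
    unfolding one_minus_logistic by (simp add: logistic_def t_def power2_eq_square)
  finally show ?thesis .
qed

lemma logistic_slope_lipschitz:
  "\<bar>logistic y * (1 - logistic y) - logistic x * (1 - logistic x)\<bar> \<le> \<bar>y - x\<bar> / 4"
proof -
  have slope: "logistic z * (1 - logistic z) \<le> 1 / 4" "0 \<le> logistic z * (1 - logistic z)" for z
    using mult_const_minus_self_real_le[of "logistic z" 1] logistic_bounds[of z] by auto
  have "\<bar>(logistic y * (1 - logistic y)) - (logistic x * (1 - logistic x))\<bar> =
        \<bar>logistic y - logistic x\<bar> * \<bar>1 - logistic x - logistic y\<bar>"
    unfolding abs_mult[symmetric] by (rule arg_cong[where f = abs]) (simp add: algebra_simps)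
  also have "\<dots> \<le> \<bar>logistic y - logistic x\<bar> * 1"
    using logistic_bounds[of x] logistic_bounds[of y] by (intro mult_left_mono) auto
  also have "\<bar>logistic y - logistic x\<bar> \<le> 1 / 4 * \<bar>y - x\<bar>"
  proof -
    have "norm (logistic y - logistic x) \<le> 1 / 4 * norm (y - x)"
      by (rule field_differentiable_bound[where S = UNIV])
         (use slope in \<open>auto intro: has_real_derivative_logistic simp flip: abs_mult\<close>)
    then show ?thesis by simp
  qed
  finally show ?thesis by simp
qed

text \<open>Subtracting the tangent leaves a function whose slope is a difference of two logistic
  slopes, at most |d|/4 between 0 and d. This is the second-order remainder of the Newton
  step.\<close>

lemma logistic_taylor:
  "\<bar>logistic (x + d) - logistic x - logistic x * (1 - logistic x) * d\<bar> \<le> d\<^sup>2 / 4"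
proof -
  define h where "h = (\<lambda>t. logistic (x + t) - logistic x * (1 - logistic x) * t)"
  have h': "(h has_real_derivative
      logistic (x + t) * (1 - logistic (x + t)) - logistic x * (1 - logistic x)) (at t)" for t
    unfolding h_def
    by (auto intro!: derivative_eq_intros DERIV_chain2[OF has_real_derivative_logistic])
  have "norm (h d - h 0) \<le> (\<bar>d\<bar> / 4) * norm (d - 0)"
  proof (rule field_differentiable_bound[where S = "cball 0 \<bar>d\<bar>"])
    show "(h has_real_derivative
        logistic (x + t) * (1 - logistic (x + t)) - logistic x * (1 - logistic x))
          (at t within cball 0 \<bar>d\<bar>)" for t
      by (rule has_field_derivative_at_within[OF h'])
    show "norm (logistic (x + t) * (1 - logistic (x + t)) - logistic x * (1 - logistic x)) \<le> \<bar>d\<bar> / 4"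
      if "t \<in> cball 0 \<bar>d\<bar>" for t
      using logistic_slope_lipschitz[of "x + t" x] that by (simp add: dist_real_def)
  qed auto
  then show ?thesis by (simp add: h_def power2_eq_square algebra_simps)
qed

lemma softplus_strict_convex:
  assumes "x \<noteq> y"
  shows "ln (1 + exp x) + logistic x * (y - x) < ln (1 + exp y)"
proof (cases "x < y")
  case True
  obtain z where z: "x < z" "z < y"
      "ln (1 + exp y) - ln (1 + exp x) = (y - x) * logistic z"
    using MVT2[OF True, of "\<lambda>x. ln (1 + exp x)" logistic] has_real_derivative_softplus by blast
  have "(y - x) * logistic x < (y - x) * logistic z"
    using True logistic_strict_mono[OF z(1)] by simp
  then show ?thesis using z(3) by (simp add: algebra_simps)
next
  case False
  then have yx: "y < x" using assms by simp
  obtain z where z: "y < z" "z < x"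
      "ln (1 + exp x) - ln (1 + exp y) = (x - y) * logistic z"
    using MVT2[OF yx, of "\<lambda>x. ln (1 + exp x)" logistic] has_real_derivative_softplus by blast
  have "(x - y) * logistic z < (x - y) * logistic x"
    using yx logistic_strict_mono[OF z(2)] by simp
  then show ?thesis using z(3) by (simp add: algebra_simps)
qed

section \<open>Potentials and critical points\<close>

text \<open>The Dirichlet form with unit conductances, over ordered pairs: a symmetric edge set
  counts every edge twice, an oriented one counts it once, and diagonal pairs contribute
  nothing.\<close>

definition energy :: "('a \<times> 'a) set \<Rightarrow> ('a \<Rightarrow> real) \<Rightarrow> real" where
  "energy A f = (\<Sum>(i, j)\<in>A. (f i - f j)\<^sup>2)"

text \<open>By Dirichlet's principle the least such R is the effective resistance. Quantifying over
  all f reduces upper bounds to inequalities between energies, so that enlarging the graph, coarse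
  graining and composing routes need no explicit flows.\<close>

definition has_resistance :: "('a \<times> 'a) set \<Rightarrow> 'a \<Rightarrow> 'a \<Rightarrow> real \<Rightarrow> bool" where
  "has_resistance A k l R \<longleftrightarrow> (\<forall>f. (f k - f l)\<^sup>2 \<le> R * energy A f)"

lemma energy_nonneg: "0 \<le> energy A f"
  unfolding energy_def by (intro sum_nonneg) auto

lemma square_le_energy:
  assumes "finite A" "(i, j) \<in> A"
  shows "(f i - f j)\<^sup>2 \<le> energy A f"
  unfolding energy_def using assms
  by (intro member_le_sum[of "(i, j)" A "\<lambda>(i, j). (f i - f j)\<^sup>2", simplified]) auto

lemma continuous_on_coordinate: "continuous_on S (\<lambda>u::nat \<Rightarrow> real. u i)"
  by (rule continuous_on_subset[OF continuous_on_product_coordinates]) simp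

lemma compact_coordinate_box:
  fixes S :: "nat \<Rightarrow> real set"
  assumes "\<And>i. compact (S i)"
  shows "compact {u. \<forall>i. u i \<in> S i}"
proof -
  have "compactin (product_topology (\<lambda>i::nat. euclidean :: real topology) UNIV) (PiE UNIV S)"
    unfolding compactin_PiE using assms by simp
  moreover have "PiE UNIV S = {u. \<forall>i. u i \<in> S i}" by (auto simp: PiE_iff)
  ultimately show ?thesis by (simp add: euclidean_product_topology)
qed

text \<open>\<open>R\<close> is any table of upper bounds for the resistances. Its finiteness for
  all pairs takes the place of connectivity: a function of zero energy is constant on the
  nodes.\<close>

locale network =
  fixes n :: nat and A :: "(nat \<times> nat) set" and R :: "nat \<Rightarrow> nat \<Rightarrow> real"
  assumes n_pos: "1 \<le> n"
    and edges: "A \<subseteq> {1..n} \<times> {1..n}"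
    and resistance: "\<And>k l. k \<in> {1..n} \<Longrightarrow> l \<in> {1..n} \<Longrightarrow> has_resistance A k l (R k l)"
    and R_nonneg: "\<And>k l. 0 \<le> R k l"
begin

lemma finite_edges: "finite A"
  using edges by (rule finite_subset) simp

lemma diff_le:
  assumes "k \<in> {1..n}" "l \<in> {1..n}"
  shows "(f k - f l)\<^sup>2 \<le> R k l * energy A f"
  using resistance[OF assms] by (simp add: has_resistance_def)

text \<open>The energy sees neither constants nor values off the nodes. Pinning node 1 to zero and
  clearing the other coordinates removes both, which makes the boxes below compact.\<close>

definition grounded :: "(nat \<Rightarrow> real) set" where
  "grounded = {u. (\<forall>i. i \<notin> {1..n} \<longrightarrow> u i = 0) \<and> u 1 = 0}"

definition box :: "real \<Rightarrow> (nat \<Rightarrow> real) set" where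
  "box c = {u \<in> grounded. \<forall>(i, j)\<in>A. \<bar>u i - u j\<bar> \<le> c}"

lemma box_iff: "u \<in> box c \<longleftrightarrow> u \<in> grounded \<and> (\<forall>(i, j)\<in>A. \<bar>u i - u j\<bar> \<le> c)"
  by (simp add: box_def)

lemma energy_box_le:
  assumes "u \<in> box c" "0 \<le> c"
  shows "energy A u \<le> real (card A) * c\<^sup>2"
proof -
  have "(u i - u j)\<^sup>2 \<le> c\<^sup>2" if "(i, j) \<in> A" for i j
  proof -
    have "\<bar>u i - u j\<bar> \<le> \<bar>c\<bar>" using assms that by (auto simp: box_iff)
    then show ?thesis by (simp add: abs_le_square_iff)
  qed
  then show ?thesis
    unfolding energy_def by (intro sum_bounded_above) auto
qed

text \<open>Bounded differences along edges bound the energy, and the resistance between i and node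
  1 turns this into a bound on coordinate i. So the box is a closed part of a product of compact
  intervals.\<close>

lemma compact_box:
  assumes "0 \<le> c"
  shows "compact (box c)"
proof -
  define b where "b = (\<lambda>i. if i \<in> {1..n} then sqrt (R i 1 * (real (card A) * c\<^sup>2)) else 0)"
  define B where "B = {u::nat \<Rightarrow> real. \<forall>i. u i \<in> {- b i..b i}}"
  define Z where "Z = {u::nat \<Rightarrow> real. (\<forall>i. i \<notin> {1..n} \<longrightarrow> u i = 0) \<and> u 1 = 0 \<and>
    (\<forall>e. e \<in> A \<longrightarrow> \<bar>u (fst e) - u (snd e)\<bar> \<le> c)}"
  have "compact B" unfolding B_def by (rule compact_coordinate_box) simp
  moreover have "closed Z"
    unfolding Z_def
    by (intro closed_Collect_conj closed_Collect_all closed_Collect_imp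
        closed_Collect_eq closed_Collect_le continuous_intros continuous_on_coordinate) auto
  moreover have "box c \<subseteq> B"
  proof
    fix u assume u: "u \<in> box c"
    have "u i \<in> {- b i..b i}" for i
    proof (cases "i \<in> {1..n}")
      case True
      have "(u i - u 1)\<^sup>2 \<le> R i 1 * energy A u"
        using True n_pos by (intro diff_le) auto
      also have "\<dots> \<le> R i 1 * (real (card A) * c\<^sup>2)"
        using energy_box_le[OF u assms] R_nonneg by (intro mult_left_mono) auto
      finally have "\<bar>u i\<bar> \<le> b i"
        using u True real_le_rsqrt[of "\<bar>u i\<bar>"] by (auto simp: b_def box_iff grounded_def)
      then show ?thesis by auto
    next
      case False
      then show ?thesis using u by (auto simp: b_def box_iff grounded_def)
    qed
    then show "u \<in> B" by (simp add: B_def)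
  qed
  moreover have "box c = Z"
    by (auto simp: box_def grounded_def Z_def)
  ultimately show ?thesis
    by (metis compact_Int_closed inf.absorb_iff2)
qed

definition ground :: "(nat \<Rightarrow> real) \<Rightarrow> nat \<Rightarrow> real" where
  "ground v = (\<lambda>i. if i \<in> {1..n} then v i - v 1 else 0)"

lemma ground_grounded: "ground v \<in> grounded"
  by (auto simp: ground_def grounded_def)

lemma ground_diff:
  assumes "i \<in> {1..n}" "j \<in> {1..n}"
  shows "ground v i - ground v j = v i - v j"
  using assms by (simp add: ground_def)

lemma edge_nodes: "(i, j) \<in> A \<Longrightarrow> i \<in> {1..n} \<and> j \<in> {1..n}"
  using edges by auto

lemma grounded_add: "u \<in> grounded \<Longrightarrow> v \<in> grounded \<Longrightarrow> (\<lambda>i. u i + t * v i) \<in> grounded"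
  by (auto simp: grounded_def)

text \<open>As in the Lax--Milgram lemma, \<open>u\<close> is the minimizer of \<open>Q u / 2 - \<phi> u\<close>.\<close>

lemma represent_functional:
  fixes w :: "nat \<Rightarrow> nat \<Rightarrow> real" and \<phi> :: "(nat \<Rightarrow> real) \<Rightarrow> real"
  assumes m: "0 < m" "\<And>i j. (i, j) \<in> A \<Longrightarrow> m \<le> w i j"
    and lin: "\<And>u v t. \<phi> (\<lambda>i. u i + t * v i) = \<phi> u + t * \<phi> v"
    and cont: "continuous_on UNIV \<phi>"
    and bound: "0 \<le> c" "\<And>v. (\<phi> v)\<^sup>2 \<le> c * energy A v"
  obtains u where "u \<in> grounded"
    "\<And>v. (\<Sum>(i, j)\<in>A. w i j * (u i - u j) * (v i - v j)) = \<phi> v"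
proof -
  define Q where "Q = (\<lambda>u::nat \<Rightarrow> real. \<Sum>(i, j)\<in>A. w i j * (u i - u j)\<^sup>2)"
  define B where "B = (\<lambda>u v::nat \<Rightarrow> real. \<Sum>(i, j)\<in>A. w i j * (u i - u j) * (v i - v j))"
  define \<Phi> where "\<Phi> = (\<lambda>u. Q u / 2 - \<phi> u)"
  \<comment> \<open>If an edge difference of v exceeds this value, then sqrt (energy) exceeds 2 sqrt
    c / m, and the quadratic part, at least m * energy / 2, outweighs \<phi>, at most sqrt (c *
    energy). So \<Phi> is nonnegative off the box, while its minimum over the box is at most
    0.\<close>
  define c' where "c' = 2 * sqrt c / m"
  have c': "0 \<le> c'" using m bound by (simp add: c'_def)
  have Q_ge: "m * energy A u \<le> Q u" for u
    unfolding Q_def energy_def sum_distrib_left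
    by (intro sum_mono) (auto intro!: mult_right_mono m)
  have contQ: "continuous_on S Q" for S
    unfolding Q_def case_prod_beta by (intro continuous_intros continuous_on_coordinate)
  have zero: "(\<lambda>_. 0) \<in> box c'" using c' by (auto simp: box_iff grounded_def)
  then have ne: "box c' \<noteq> {}" by auto
  have "continuous_on (box c') \<Phi>"
    unfolding \<Phi>_def by (intro continuous_intros contQ continuous_on_subset[OF cont]) auto
  then obtain u where u: "u \<in> box c'" "\<And>v. v \<in> box c' \<Longrightarrow> \<Phi> u \<le> \<Phi> v"
    using continuous_attains_inf[OF compact_box[OF c'] ne] by blast
  have l0: "\<phi> (\<lambda>_. 0) = 0"
    using bound(2)[of "\<lambda>_. 0"] by (simp add: energy_def)
  have "\<Phi> (\<lambda>_. 0) = 0" by (simp add: \<Phi>_def Q_def l0)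
  with u(2)[OF zero] have u0: "\<Phi> u \<le> 0" by simp
  have min: "\<Phi> u \<le> \<Phi> v" if v: "v \<in> grounded" for v
  proof (cases "v \<in> box c'")
    case False
    then obtain i j where ij: "(i, j) \<in> A" "c' < \<bar>v i - v j\<bar>"
      using v by (auto simp: box_iff not_le)
    define s where "s = sqrt (energy A v)"
    have s2: "s * s = energy A v" by (simp add: s_def energy_nonneg)
    have s0: "0 \<le> s" by (simp add: s_def energy_nonneg)
    have "\<bar>v i - v j\<bar> \<le> s"
      unfolding s_def by (rule real_le_rsqrt) (use square_le_energy[OF finite_edges ij(1)] in simp)
    with ij have "c' < s" by simp
    then have s1: "2 * sqrt c < m * s" using m by (simp add: c'_def field_simps)
    have "\<bar>\<phi> v\<bar> \<le> sqrt (c * energy A v)"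
      by (rule real_le_rsqrt) (use bound in simp)
    then have "\<phi> v \<le> sqrt c * s" by (simp add: real_sqrt_mult s_def)
    also have "2 * (sqrt c * s) \<le> m * s * s"
      using mult_right_mono[OF less_imp_le[OF s1] s0] by simp
    then have "sqrt c * s \<le> m * energy A v / 2" by (simp add: s2[symmetric])
    also have "m * energy A v / 2 \<le> Q v / 2" using Q_ge[of v] by simp
    finally have "0 \<le> \<Phi> v" by (simp add: \<Phi>_def)
    then show ?thesis using u0 by simp
  qed (use u in auto)
  have B_grounded: "B u v = \<phi> v" if v: "v \<in> grounded" for v
  proof -
    have quad: "0 \<le> t * (B u v - \<phi> v) + t\<^sup>2 * (Q v / 2)" for t
    proof -
      have "Q (\<lambda>i. u i + t * v i) = Q u + 2 * t * B u v + t\<^sup>2 * Q v"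
        unfolding Q_def B_def sum_distrib_left sum.distrib[symmetric]
        by (rule sum.cong) (auto simp: power2_eq_square algebra_simps)
      moreover have "\<Phi> u \<le> \<Phi> (\<lambda>i. u i + t * v i)"
        using u v by (intro min grounded_add) (auto simp: box_iff)
      ultimately show ?thesis by (simp add: \<Phi>_def lin algebra_simps)
    qed
    define D where "D = B u v - \<phi> v"
    \<comment> \<open>The added 1 keeps the divisor positive even if \<open>Q v = 0\<close>. At t =
      -D / (2 q) the nonnegative quadratic is at most -D^2 / (4 q), which forces D = 0.\<close>
    define q where "q = Q v / 2 + 1"
    have q: "0 < q"
      using Q_ge[of v] energy_nonneg[of A v] m
        mult_nonneg_nonneg[of m "energy A v"] unfolding q_def by linarith
    have "0 \<le> (- D / (2 * q)) * D + (- D / (2 * q))\<^sup>2 * (Q v / 2)"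
      using quad[of "- D / (2 * q)"] by (simp add: D_def)
    also have "\<dots> \<le> (- D / (2 * q)) * D + (- D / (2 * q))\<^sup>2 * q"
      by (intro add_left_mono mult_left_mono) (auto simp: q_def)
    also have "\<dots> = - (D\<^sup>2 / (4 * q))"
      using q by (simp add: power2_eq_square field_simps)
    finally have "D\<^sup>2 / (4 * q) \<le> 0" by simp
    then have "D = 0" using q by (simp add: divide_le_0_iff)
    then show ?thesis by (simp add: D_def)
  qed
  have "B u v = \<phi> v" for v
  proof -
    have "B u v = B u (ground v)"
      unfolding B_def by (rule sum.cong) (auto simp: ground_diff dest!: edge_nodes)
    moreover have "\<phi> (ground v) = \<phi> v"
    proof -
      define z where "z = (\<lambda>i. v i + (-1) * ground v i)"
      have "energy A z = 0"
        unfolding energy_def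
      proof (intro sum.neutral ballI, clarify)
        fix i j assume "(i, j) \<in> A"
        then show "(z i - z j)\<^sup>2 = 0"
          using ground_diff[of i j v] by (auto simp: z_def dest!: edge_nodes)
      qed
      then have "\<phi> z = 0" using bound(2)[of z] by simp
      then show ?thesis using lin[of v "-1" "ground v"] by (simp add: z_def)
    qed
    ultimately show ?thesis using B_grounded[OF ground_grounded] by simp
  qed
  moreover have "u \<in> grounded" using u by (simp add: box_iff)
  ultimately show ?thesis using that unfolding B_def by blast
qed

end


section \<open>Potentials of the Hessian and the Newton step\<close>

locale btl_network = network +
  fixes \<theta>s :: "nat \<Rightarrow> real" and \<kappa> :: real and L :: nat
  assumes kappa: "1 \<le> \<kappa>"
    and edge_range: "\<And>i j. (i, j) \<in> A \<Longrightarrow> \<bar>\<theta>s i - \<theta>s j\<bar> \<le> ln \<kappa>"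
    and L_pos: "1 \<le> L"
begin

definition weight :: "nat \<Rightarrow> nat \<Rightarrow> real" where
  "weight i j = real L * (logistic (\<theta>s i - \<theta>s j) * (1 - logistic (\<theta>s i - \<theta>s j)))"

lemma weight_ge: "(i, j) \<in> A \<Longrightarrow> real L / (4 * \<kappa>) \<le> weight i j"
  using mult_left_mono[OF logistic_slope_ge[OF kappa edge_range], of i j "real L"]
  by (simp add: weight_def)

lemma weight_lower_pos: "0 < real L / (4 * \<kappa>)"
  using kappa L_pos by simp

text \<open>The weak form of H u = e_k - e_l. It determines u on the nodes only up to a constant, so
  an arbitrary choice is harmless as long as only differences are used.\<close>

definition potential :: "nat \<Rightarrow> nat \<Rightarrow> nat \<Rightarrow> real" where
  "potential k l = (SOME u. \<forall>v. (\<Sum>(i, j)\<in>A. weight i j * (u i - u j) * (v i - v j)) = v k - v l)"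

lemma potential:
  assumes "k \<in> {1..n}" "l \<in> {1..n}"
  shows "(\<Sum>(i, j)\<in>A. weight i j * (potential k l i - potential k l j) * (v i - v j)) = v k - v l"
proof -
  obtain u where
    "\<And>v. (\<Sum>(i, j)\<in>A. weight i j * (u i - u j) * (v i - v j)) = v k - v l"
  proof (rule represent_functional[OF weight_lower_pos weight_ge, where \<phi> = "\<lambda>v. v k - v l"])
    show "continuous_on UNIV (\<lambda>v::nat \<Rightarrow> real. v k - v l)"
      by (intro continuous_intros continuous_on_coordinate)
    show "0 \<le> R k l" by (rule R_nonneg)
    show "(v k - v l)\<^sup>2 \<le> R k l * energy A v" for v by (rule diff_le[OF assms])
  qed (auto simp: algebra_simps)
  then show ?thesis
    unfolding potential_def by (rule someI2[where Q = "\<lambda>u. (\<Sum>(i, j)\<in>A. weight i j * (u i - u j) * (v i - v j)) = v k - v l", OF allI]) blast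
qed

text \<open>Testing the equation with u itself gives m E \<le> u k - u l \<le> sqrt (R E), where m =
  L / (4 \<kappa>) is the lower bound of the weights. Hence E \<le> R / m^2.\<close>

lemma energy_potential:
  assumes "k \<in> {1..n}" "l \<in> {1..n}"
  shows "energy A (potential k l) \<le> 16 * \<kappa>\<^sup>2 * R k l / (real L)\<^sup>2"
proof -
  define u where "u = potential k l"
  define E where "E = energy A u"
  define m where "m = real L / (4 * \<kappa>)"
  have m: "0 < m" using weight_lower_pos by (simp add: m_def)
  have E: "0 \<le> E" by (simp add: E_def energy_nonneg)
  have "m * E \<le> (\<Sum>(i, j)\<in>A. weight i j * (u i - u j) * (u i - u j))"
    unfolding E_def energy_def sum_distrib_left
  proof (rule sum_mono, clarify)
    fix i j assume "(i, j) \<in> A"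
    then show "m * (u i - u j)\<^sup>2 \<le> weight i j * (u i - u j) * (u i - u j)"
      using mult_right_mono[OF weight_ge, of i j "(u i - u j)\<^sup>2"]
      by (simp add: m_def power2_eq_square mult.assoc)
  qed
  also have "\<dots> = u k - u l" unfolding u_def by (rule potential[OF assms])
  finally have "(m * E)\<^sup>2 \<le> (u k - u l)\<^sup>2" using m E by (intro power_mono) auto
  also have "\<dots> \<le> R k l * E" unfolding E_def by (rule diff_le[OF assms])
  finally have *: "m\<^sup>2 * E * E \<le> R k l * E" by (simp add: power2_eq_square mult_ac)
  have "m\<^sup>2 * E \<le> R k l"
  proof (cases "E = 0")
    case False
    then show ?thesis using * E by simp
  qed (use R_nonneg in simp)
  then have "E \<le> R k l / m\<^sup>2" using m by (simp add: field_simps)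
  also have "\<dots> = 16 * \<kappa>\<^sup>2 * R k l / (real L)\<^sup>2" by (simp add: m_def power_divide power_mult_distrib)
  finally show ?thesis by (simp add: E_def u_def)
qed

text \<open>The remainder is controlled only uniformly over the edges, so it is paired with the l1
  norm of the differences, and Cauchy--Schwarz costs sqrt (card A). The factor sqrt (R k l) is the
  same as in the noise bound, which lets it cancel from the condition on L.\<close>

lemma sum_abs_potential:
  assumes "k \<in> {1..n}" "l \<in> {1..n}"
  shows "real L * (\<Sum>(i, j)\<in>A. \<bar>potential k l i - potential k l j\<bar>) \<le> 4 * \<kappa> * sqrt (real (card A)) * sqrt (R k l)"
proof -
  define u where "u = potential k l"
  define S where "S = (\<Sum>(i, j)\<in>A. \<bar>u i - u j\<bar>)"
  have "S\<^sup>2 \<le> energy A u * real (card A)"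
    using sum_squared_le_sum_of_squares[of "\<lambda>(i, j). \<bar>u i - u j\<bar>" A]
    unfolding S_def energy_def by (simp add: case_prod_beta mult.commute)
  also have "\<dots> \<le> 16 * \<kappa>\<^sup>2 * R k l / (real L)\<^sup>2 * real (card A)"
    unfolding u_def by (intro mult_right_mono energy_potential assms) auto
  finally have "(real L * S)\<^sup>2 \<le> 16 * \<kappa>\<^sup>2 * R k l * real (card A)"
    using L_pos by (simp add: power_mult_distrib field_simps)
  also have "\<dots> = (4 * \<kappa> * sqrt (real (card A)) * sqrt (R k l))\<^sup>2"
    using R_nonneg by (simp add: power_mult_distrib)
  finally have "real L * S \<le> 4 * \<kappa> * sqrt (real (card A)) * sqrt (R k l)"
    by (rule power2_le_imp_le) (use kappa R_nonneg in auto)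
  then show ?thesis by (simp add: S_def u_def)
qed

text \<open>Let \<open>x\<close> be the Newton step, with the Hessian taken at the true scores, from the minimizer
  \<open>d\<close> of the likelihood over a small box. Since \<open>x\<close> stays in the box, minimality says that the
  directional derivative along \<open>x - d\<close> is nonnegative, but it equals \<open>- B (x - d) (x - d)\<close> for the
  Hessian form \<open>B\<close>. Hence \<open>x = d\<close>, so \<open>d\<close> is a critical point.\<close>

lemma critical_point:
  fixes c :: "nat \<Rightarrow> nat \<Rightarrow> real"
  assumes lam: "0 \<le> \<tau>" and Q: "0 \<le> Q" "\<And>i j. (i, j) \<in> A \<Longrightarrow> R i j \<le> Q"
    and size: "256 * \<kappa> ^ 4 * Q\<^sup>2 * real (card A) * \<tau> \<le> real L"
    and noise: "\<And>k l. k \<in> {1..n} \<Longrightarrow> l \<in> {1..n} \<Longrightarrow>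
      \<bar>\<Sum>(i, j)\<in>A. (real L * logistic (\<theta>s i - \<theta>s j) - c i j) * (potential k l i - potential k l j)\<bar>
        \<le> 4 * \<kappa> * sqrt (R k l) * sqrt (\<tau> / real L)"
  obtains d where
    "\<And>v. (\<Sum>(i, j)\<in>A. (real L * logistic (\<theta>s i - \<theta>s j + (d i - d j)) - c i j) * (v i - v j)) = 0"
    "\<And>k l. k \<in> {1..n} \<Longrightarrow> l \<in> {1..n} \<Longrightarrow>
      \<bar>d k - d l\<bar> \<le> 8 * \<kappa> * sqrt (R k l) * sqrt (\<tau> / real L)"
proof -
  define a where "a = sqrt (\<tau> / real L)"
  have a: "0 \<le> a" "a\<^sup>2 = \<tau> / real L" using lam by (auto simp: a_def)
  \<comment> \<open>Twice the noise bound at resistance Q: one half is for the noise, the other for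
    the remainder.\<close>
  define \<epsilon> where "\<epsilon> = 8 * \<kappa> * sqrt Q * a"
  have eps: "0 \<le> \<epsilon>" using a Q kappa by (simp add: \<epsilon>_def)
  \<comment> \<open>The sample-size condition in the form used below: 256 is 16^2, and \<epsilon>^2
    = 64 \<kappa>^2 Q a^2 is 4 a times 16 \<kappa>^2 Q a.\<close>
  have eps2: "\<epsilon>\<^sup>2 * sqrt (real (card A)) \<le> 4 * a"
  proof -
    have "(16 * \<kappa>\<^sup>2 * Q * a * sqrt (real (card A)))\<^sup>2 = 256 * \<kappa> ^ 4 * Q\<^sup>2 * real (card A) * \<tau> / real L"
      by (simp add: power_mult_distrib a(2))
    also have "\<dots> \<le> 1\<^sup>2" using size L_pos by simp
    finally have "16 * \<kappa>\<^sup>2 * Q * a * sqrt (real (card A)) \<le> 1"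
      by (rule power2_le_imp_le) simp
    then have "4 * a * (16 * \<kappa>\<^sup>2 * Q * a * sqrt (real (card A))) \<le> 4 * a * 1"
      using a by (intro mult_left_mono) auto
    moreover have "\<epsilon>\<^sup>2 = 64 * \<kappa>\<^sup>2 * Q * (a * a)"
      using Q by (simp add: \<epsilon>_def power_mult_distrib power2_eq_square)
    ultimately show ?thesis by (simp add: mult_ac)
  qed
  define rem where "rem = (\<lambda>(d::nat \<Rightarrow> real) i j. logistic (\<theta>s i - \<theta>s j + (d i - d j)) - logistic (\<theta>s i - \<theta>s j)
    - logistic (\<theta>s i - \<theta>s j) * (1 - logistic (\<theta>s i - \<theta>s j)) * (d i - d j))"
  define F where "F = (\<lambda>d::nat \<Rightarrow> real. \<Sum>(i, j)\<in>A. real L * ln (1 + exp (\<theta>s i - \<theta>s j + (d i - d j))) - c i j * (d i - d j))"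
  define G where "G = (\<lambda>d v::nat \<Rightarrow> real. \<Sum>(i, j)\<in>A. (real L * logistic (\<theta>s i - \<theta>s j + (d i - d j)) - c i j) * (v i - v j))"
  \<comment> \<open>The gradient at d without its linear part, that is, the noise plus the
    second-order remainder.\<close>
  define p where "p = (\<lambda>d i j. real L * logistic (\<theta>s i - \<theta>s j) - c i j + real L * rem d i j)"
  have rem_le: "\<bar>rem d i j\<bar> \<le> \<epsilon>\<^sup>2 / 4" if "d \<in> box \<epsilon>" "(i, j) \<in> A" for d i j
  proof -
    have "\<bar>rem d i j\<bar> \<le> (d i - d j)\<^sup>2 / 4" unfolding rem_def by (rule logistic_taylor)
    moreover have "(d i - d j)\<^sup>2 \<le> \<epsilon>\<^sup>2"
      using that eps by (subst abs_le_square_iff[symmetric]) (auto simp: box_iff)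
    ultimately show ?thesis by simp
  qed
  have grad: "G d v = (\<Sum>(i, j)\<in>A. p d i j * (v i - v j)) +
      (\<Sum>(i, j)\<in>A. weight i j * (d i - d j) * (v i - v j))" for d v
    unfolding G_def p_def rem_def weight_def sum.distrib[symmetric]
    by (rule sum.cong) (auto simp: algebra_simps)
  have newton: "\<exists>x\<in>box \<epsilon>. (\<forall>v. (\<Sum>(i, j)\<in>A. weight i j * (x i - x j) * (v i - v j)) =
        - (\<Sum>(i, j)\<in>A. p d i j * (v i - v j))) \<and>
      (\<forall>k\<in>{1..n}. \<forall>l\<in>{1..n}. \<bar>x k - x l\<bar> \<le> 8 * \<kappa> * sqrt (R k l) * a)"
    if d: "d \<in> box \<epsilon>" for d
  proof -
    obtain x where x: "x \<in> grounded"
      "\<And>v. (\<Sum>(i, j)\<in>A. weight i j * (x i - x j) * (v i - v j)) = - (\<Sum>(i, j)\<in>A. p d i j * (v i - v j))"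
    proof (rule represent_functional[OF weight_lower_pos weight_ge,
          where \<phi> = "\<lambda>v. - (\<Sum>(i, j)\<in>A. p d i j * (v i - v j))"])
      show "continuous_on UNIV (\<lambda>v::nat \<Rightarrow> real. - (\<Sum>(i, j)\<in>A. p d i j * (v i - v j)))"
        unfolding case_prod_beta by (intro continuous_intros continuous_on_coordinate)
      show "(- (\<Sum>(i, j)\<in>A. p d i j * (v i - v j)))\<^sup>2 \<le> (\<Sum>(i, j)\<in>A. (p d i j)\<^sup>2) * energy A v" for v
        using Cauchy_Schwarz_ineq_sum[of "\<lambda>(i, j). p d i j" "\<lambda>(i, j). v i - v j" A]
        by (simp add: energy_def case_prod_beta)
      show "0 \<le> (\<Sum>(i, j)\<in>A. (p d i j)\<^sup>2)" by (intro sum_nonneg) auto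
      show "- (\<Sum>(i, j)\<in>A. p d i j * ((u i + t * v i) - (u j + t * v j))) =
          - (\<Sum>(i, j)\<in>A. p d i j * (u i - u j)) + t * - (\<Sum>(i, j)\<in>A. p d i j * (v i - v j))" for u v t
        by (simp add: sum_distrib_left sum.distrib[symmetric] sum_negf[symmetric] case_prod_beta algebra_simps
            cong: sum.cong)
    qed auto
    have bound: "\<bar>x k - x l\<bar> \<le> 8 * \<kappa> * sqrt (R k l) * a" if kl: "k \<in> {1..n}" "l \<in> {1..n}" for k l
    proof -
      \<comment> \<open>Green's identity: pairing the Newton equation with the potential and using
        the symmetry of the form expresses x k - x l through p alone.\<close>
      define u where "u = potential k l"
      have "x k - x l = (\<Sum>(i, j)\<in>A. weight i j * (u i - u j) * (x i - x j))"
        unfolding u_def by (rule potential[OF kl, symmetric])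
      also have "\<dots> = (\<Sum>(i, j)\<in>A. weight i j * (x i - x j) * (u i - u j))"
        by (rule sum.cong) auto
      also have "\<dots> = - (\<Sum>(i, j)\<in>A. p d i j * (u i - u j))" by (rule x(2))
      also have "(\<Sum>(i, j)\<in>A. p d i j * (u i - u j)) =
          (\<Sum>(i, j)\<in>A. (real L * logistic (\<theta>s i - \<theta>s j) - c i j) * (u i - u j)) +
          real L * (\<Sum>(i, j)\<in>A. rem d i j * (u i - u j))"
        unfolding p_def sum_distrib_left sum.distrib[symmetric]
        by (rule sum.cong) (auto simp: algebra_simps)
      finally have "\<bar>x k - x l\<bar> \<le>
          \<bar>\<Sum>(i, j)\<in>A. (real L * logistic (\<theta>s i - \<theta>s j) - c i j) * (u i - u j)\<bar> +
          real L * \<bar>\<Sum>(i, j)\<in>A. rem d i j * (u i - u j)\<bar>"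
        by (simp add: abs_mult[symmetric, of "real L", simplified])
      also have "\<dots> \<le> 4 * \<kappa> * sqrt (R k l) * a + real L * (\<epsilon>\<^sup>2 / 4 * (\<Sum>(i, j)\<in>A. \<bar>u i - u j\<bar>))"
      proof (intro add_mono mult_left_mono)
        show "\<bar>\<Sum>(i, j)\<in>A. rem d i j * (u i - u j)\<bar> \<le> \<epsilon>\<^sup>2 / 4 * (\<Sum>(i, j)\<in>A. \<bar>u i - u j\<bar>)"
          unfolding sum_distrib_left
        proof (rule order_trans[OF sum_abs], rule sum_mono, clarify)
          fix i j assume "(i, j) \<in> A"
          then show "\<bar>rem d i j * (u i - u j)\<bar> \<le> \<epsilon>\<^sup>2 / 4 * \<bar>u i - u j\<bar>"
            unfolding abs_mult by (intro mult_right_mono rem_le d) auto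
        qed
      qed (use noise[OF kl] in \<open>auto simp: u_def a_def\<close>)
      also have "real L * (\<epsilon>\<^sup>2 / 4 * (\<Sum>(i, j)\<in>A. \<bar>u i - u j\<bar>)) \<le>
          \<epsilon>\<^sup>2 / 4 * (4 * \<kappa> * sqrt (real (card A)) * sqrt (R k l))"
        using mult_left_mono[OF sum_abs_potential[OF kl], of "\<epsilon>\<^sup>2 / 4"] by (simp add: u_def mult_ac)
      also have "\<dots> = \<kappa> * sqrt (R k l) * (\<epsilon>\<^sup>2 * sqrt (real (card A)))" by simp
      also have "\<dots> \<le> \<kappa> * sqrt (R k l) * (4 * a)"
        using eps2 kappa R_nonneg by (intro mult_left_mono) auto
      finally show ?thesis by (simp add: mult_ac)
    qed
    have "\<bar>x i - x j\<bar> \<le> \<epsilon>" if "(i, j) \<in> A" for i j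
    proof -
      have "\<bar>x i - x j\<bar> \<le> 8 * \<kappa> * sqrt (R i j) * a" using that by (intro bound) (auto dest: edge_nodes)
      also have "\<dots> \<le> \<epsilon>"
        unfolding \<epsilon>_def using Q(2)[OF that] kappa a by (intro mult_right_mono mult_left_mono) auto
      finally show ?thesis .
    qed
    then show ?thesis using x bound by (intro bexI[of _ x]) (auto simp: box_iff)
  qed
  have "continuous_on (box \<epsilon>) F"
    unfolding F_def case_prod_beta
    by (intro continuous_intros continuous_on_coordinate) (auto simp: add_pos_pos less_imp_neq[THEN not_sym])
  moreover have "box \<epsilon> \<noteq> {}"
    using eps by (auto simp: box_def grounded_def intro!: exI[of _ "\<lambda>_. 0"])
  ultimately obtain d where d: "d \<in> box \<epsilon>" "\<And>v. v \<in> box \<epsilon> \<Longrightarrow> F d \<le> F v"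
    using continuous_attains_inf[OF compact_box[OF eps]] by blast
  obtain x where x: "x \<in> box \<epsilon>"
      "\<And>v. (\<Sum>(i, j)\<in>A. weight i j * (x i - x j) * (v i - v j)) = - (\<Sum>(i, j)\<in>A. p d i j * (v i - v j))"
      "\<And>k l. k \<in> {1..n} \<Longrightarrow> l \<in> {1..n} \<Longrightarrow> \<bar>x k - x l\<bar> \<le> 8 * \<kappa> * sqrt (R k l) * a"
    using newton[OF d(1)] by blast
  define z where "z = (\<lambda>i. x i - d i)"
  have Gz: "G d v = - (\<Sum>(i, j)\<in>A. weight i j * (z i - z j) * (v i - v j))" for v
  proof -
    have "(\<Sum>(i, j)\<in>A. weight i j * (z i - z j) * (v i - v j)) =
        (\<Sum>(i, j)\<in>A. weight i j * (x i - x j) * (v i - v j)) - (\<Sum>(i, j)\<in>A. weight i j * (d i - d j) * (v i - v j))"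
      unfolding sum_subtractf[symmetric] z_def by (rule sum.cong) (auto simp: algebra_simps)
    then show ?thesis using grad[of d v] x(2)[of v] by simp
  qed
  have in_box: "(\<lambda>i. d i + t * z i) \<in> box \<epsilon>" if t: "0 \<le> t" "t \<le> 1" for t
  proof -
    have "\<bar>d i + t * z i - (d j + t * z j)\<bar> \<le> \<epsilon>" if e: "(i, j) \<in> A" for i j
    proof -
      have "d i + t * z i - (d j + t * z j) = (1 - t) * (d i - d j) + t * (x i - x j)"
        by (simp add: z_def algebra_simps)
      also have "\<bar>\<dots>\<bar> \<le> (1 - t) * \<bar>d i - d j\<bar> + t * \<bar>x i - x j\<bar>"
        using t by (intro order_trans[OF abs_triangle_ineq]) (simp add: abs_mult)
      also have "\<dots> \<le> (1 - t) * \<epsilon> + t * \<epsilon>"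
        using t d(1) x(1) e by (intro add_mono mult_left_mono) (auto simp: box_iff)
      finally show ?thesis by (simp add: algebra_simps)
    qed
    then show ?thesis using d(1) x(1) by (auto simp: box_iff grounded_def z_def)
  qed
  have deriv: "((\<lambda>t. F (\<lambda>i. d i + t * z i)) has_real_derivative G d z) (at 0)"
  proof -
    have "((\<lambda>t. real L * ln (1 + exp (\<theta>s i - \<theta>s j + (d i + t * z i - (d j + t * z j)))) -
          c i j * (d i + t * z i - (d j + t * z j)))
        has_real_derivative (real L * logistic (\<theta>s i - \<theta>s j + (d i - d j)) - c i j) * (z i - z j)) (at 0)"
      for i j
    proof -
      have "((\<lambda>t. \<theta>s i - \<theta>s j + (d i + t * z i - (d j + t * z j)))
          has_real_derivative (z i - z j)) (at 0)"
        by (auto intro!: derivative_eq_intros)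
      from DERIV_chain2[OF has_real_derivative_softplus this]
      have "((\<lambda>t. ln (1 + exp (\<theta>s i - \<theta>s j + (d i + t * z i - (d j + t * z j)))))
          has_real_derivative logistic (\<theta>s i - \<theta>s j + (d i - d j)) * (z i - z j)) (at 0)"
        by simp
      moreover have "((\<lambda>t. d i + t * z i - (d j + t * z j)) has_real_derivative (z i - z j)) (at 0)"
        by (auto intro!: derivative_eq_intros)
      ultimately have "((\<lambda>t. real L * ln (1 + exp (\<theta>s i - \<theta>s j + (d i + t * z i - (d j + t * z j)))) -
            c i j * (d i + t * z i - (d j + t * z j)))
          has_real_derivative real L * (logistic (\<theta>s i - \<theta>s j + (d i - d j)) * (z i - z j)) -
            c i j * (z i - z j)) (at 0)"
        by (rule DERIV_diff[OF DERIV_cmult DERIV_cmult])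
      then show ?thesis by (simp add: left_diff_distrib mult.assoc)
    qed
    then show ?thesis
      unfolding F_def G_def case_prod_beta by (intro DERIV_sum)
  qed
  have "0 \<le> G d z"
  proof (rule ccontr)
    assume "\<not> 0 \<le> G d z"
    then obtain h0 where h0: "0 < h0"
        "\<And>h. 0 < h \<Longrightarrow> h < h0 \<Longrightarrow> F (\<lambda>i. d i + (0 + h) * z i) < F (\<lambda>i. d i + 0 * z i)"
      using DERIV_neg_dec_right[OF deriv] by auto
    define h where "h = min 1 (h0 / 2)"
    have "F (\<lambda>i. d i + h * z i) < F d" using h0(2)[of h] h0(1) by (simp add: h_def)
    moreover have "F d \<le> F (\<lambda>i. d i + h * z i)"
      using h0(1) by (intro d(2) in_box) (auto simp: h_def)
    ultimately show False by simp
  qed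
  then have "(\<Sum>(i, j)\<in>A. weight i j * (z i - z j) * (z i - z j)) \<le> 0" by (simp add: Gz)
  moreover have "real L / (4 * \<kappa>) * energy A z \<le> (\<Sum>(i, j)\<in>A. weight i j * (z i - z j) * (z i - z j))"
    unfolding energy_def sum_distrib_left
  proof (rule sum_mono, clarify)
    fix i j assume "(i, j) \<in> A"
    then show "real L / (4 * \<kappa>) * (z i - z j)\<^sup>2 \<le> weight i j * (z i - z j) * (z i - z j)"
      using mult_right_mono[OF weight_ge, of i j "(z i - z j)\<^sup>2"]
      by (simp add: power2_eq_square mult.assoc)
  qed
  ultimately have "real L / (4 * \<kappa>) * energy A z \<le> 0" by linarith
  then have z0: "energy A z = 0"
    using mult_pos_pos[OF weight_lower_pos, of "energy A z"] energy_nonneg[of A z] by linarith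
  have z_const: "z k = z l" if "k \<in> {1..n}" "l \<in> {1..n}" for k l
    using diff_le[OF that, of z] z0 by simp
  show thesis
  proof (rule that)
    fix v
    have "G d v = 0"
    proof -
      have "z i - z j = 0" if "(i, j) \<in> A" for i j
        using z_const[of i j] edge_nodes[OF that] by auto
      then have "(\<Sum>(i, j)\<in>A. weight i j * (z i - z j) * (v i - v j)) = 0"
        by (intro sum.neutral) auto
      then show ?thesis by (simp add: Gz)
    qed
    then show "(\<Sum>(i, j)\<in>A. (real L * logistic (\<theta>s i - \<theta>s j + (d i - d j)) - c i j) * (v i - v j)) = 0"
      by (simp add: G_def)
  next
    fix k l assume kl: "k \<in> {1..n}" "l \<in> {1..n}"
    have "d k - d l = x k - x l" using z_const[OF kl] by (simp add: z_def)
    then show "\<bar>d k - d l\<bar> \<le> 8 * \<kappa> * sqrt (R k l) * sqrt (\<tau> / real L)"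
      using x(3)[OF kl] by (simp add: a_def)
  qed
qed

end

section \<open>Concentration and the maximum likelihood estimator\<close>

definition oriented :: "(nat \<times> nat) set \<Rightarrow> (nat \<times> nat) set" where
  "oriented E = {(i, j). (i, j) \<in> E \<and> i < j}"

definition wins :: "nat \<Rightarrow> (nat \<times> nat \<times> nat \<Rightarrow> bool) \<Rightarrow> nat \<Rightarrow> nat \<Rightarrow> real" where
  "wins L y i j = (\<Sum>l=1..L. of_bool (y (i, j, l)))"

lemma neg_log_likelihood_eq:
  "neg_log_likelihood E (\<lambda>_ _. L) y \<theta> =
     (\<Sum>(i, j)\<in>oriented E. real L * ln (1 + exp (\<theta> i - \<theta> j)) - wins L y i j * (\<theta> i - \<theta> j))"
  unfolding neg_log_likelihood_def oriented_def wins_def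
  by (rule sum.cong) (auto simp: sum.distrib sum_subtractf sum_negf sum_distrib_right)

lemma sample_indices_eq:
  "sample_indices E (\<lambda>_ _. L) = (\<lambda>((i, j), l). (i, j, l)) ` (oriented E \<times> {1..L})"
  by (auto simp: sample_indices_def oriented_def image_iff)

lemma sum_sample_indices:
  "(\<Sum>(i, j, l)\<in>sample_indices E (\<lambda>_ _. L). g i j l) = (\<Sum>(i, j)\<in>oriented E. \<Sum>l=1..L. g i j l)"
proof -
  have inj: "inj_on (\<lambda>((i, j), l). (i, j, l)) (oriented E \<times> {1..L})"
    by (auto simp: inj_on_def)
  show ?thesis
    unfolding sample_indices_eq sum.reindex[OF inj]
    by (simp add: case_prod_beta sum.cartesian_product)
qed

text \<open>Hoeffding's inequality over all samples of all edges: a sample times u i - u j ranges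
  over an interval of length |u i - u j|, so the squared widths add up to L * energy. The event is
  strict so that t = 0 is allowed: if all widths vanish, it is empty.\<close>

lemma noise_tail:
  fixes u :: "nat \<Rightarrow> real"
  assumes fin: "finite (oriented E)" and s: "real L * energy (oriented E) u \<le> s" and t: "0 \<le> t"
    and q: "2 * t\<^sup>2 \<ge> s * q"
  shows "measure_pmf.prob (btl_samples E (\<lambda>_ _. L) \<theta>s)
    {y. t < \<bar>\<Sum>(i, j)\<in>oriented E. (real L * logistic (\<theta>s i - \<theta>s j) - wins L y i j) * (u i - u j)\<bar>}
      \<le> 2 * exp (- q)"
proof -
  define I where "I = sample_indices E (\<lambda>_ _. L)"
  define P where "P = btl_samples E (\<lambda>_ _. L) \<theta>s"
  define X where "X = (\<lambda>(i, j, l) (y :: nat \<times> nat \<times> nat \<Rightarrow> bool). of_bool (y (i, j, l)) * (u i - u j))"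
  define a where "a = (\<lambda>(i, j, l::nat). min 0 (u i - u j))"
  define b where "b = (\<lambda>(i, j, l::nat). max 0 (u i - u j))"
  have finI: "finite I" using fin by (simp add: I_def sample_indices_eq)
  interpret H: Hoeffding_ineq "measure_pmf P" I X a b "\<Sum>x\<in>I. measure_pmf.expectation P (X x)"
  proof unfold_locales
    show "finite I" by (rule finI)
    have "prob_space.indep_vars (measure_pmf P) (\<lambda>_. count_space UNIV) (\<lambda>x f. f x) I"
      unfolding P_def btl_samples_def I_def[symmetric] by (rule indep_vars_Pi_pmf[OF finI])
    from prob_space.indep_vars_compose2[OF measure_pmf.prob_space_axioms this, of "\<lambda>x v. of_bool v * (u (fst x) - u (fst (snd x)))" "\<lambda>_. borel"]
    show "prob_space.indep_vars (measure_pmf P) (\<lambda>_. borel) X I"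
      by (simp add: X_def case_prod_unfold)
    show "AE y in measure_pmf P. X x y \<in> {a x..b x}" for x
      by (auto simp: X_def a_def b_def split: prod.split)
  qed simp
  have exps: "measure_pmf.expectation P (X (i, j, l)) = logistic (\<theta>s i - \<theta>s j) * (u i - u j)"
    if "(i, j, l) \<in> I" for i j l
  proof -
    have "measure_pmf.expectation P (X (i, j, l)) =
        measure_pmf.expectation (map_pmf (\<lambda>f. f (i, j, l)) P) (\<lambda>v. of_bool v * (u i - u j))"
      by (simp add: X_def)
    also have "map_pmf (\<lambda>f. f (i, j, l)) P = bernoulli_pmf (logistic (\<theta>s i - \<theta>s j))"
      unfolding P_def btl_samples_def I_def[symmetric]
      using that by (subst Pi_pmf_component[OF finI]) simp
    also have "measure_pmf.expectation \<dots> (\<lambda>v. of_bool v * (u i - u j)) = logistic (\<theta>s i - \<theta>s j) * (u i - u j)"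
      using logistic_bounds[of "\<theta>s i - \<theta>s j"] by (subst integral_bernoulli_pmf) auto
    finally show ?thesis .
  qed
  have mean: "(\<Sum>x\<in>I. measure_pmf.expectation P (X x)) =
      (\<Sum>(i, j)\<in>oriented E. real L * logistic (\<theta>s i - \<theta>s j) * (u i - u j))"
  proof -
    have "(\<Sum>x\<in>I. measure_pmf.expectation P (X x)) = (\<Sum>(i, j, l)\<in>I. logistic (\<theta>s i - \<theta>s j) * (u i - u j))"
      by (rule sum.cong) (auto simp: exps)
    also have "\<dots> = (\<Sum>(i, j)\<in>oriented E. real L * logistic (\<theta>s i - \<theta>s j) * (u i - u j))"
      unfolding I_def sum_sample_indices by (rule sum.cong) auto
    finally show ?thesis .
  qed
  have total: "(\<Sum>x\<in>I. X x y) = (\<Sum>(i, j)\<in>oriented E. wins L y i j * (u i - u j))" for y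
  proof -
    have "(\<Sum>x\<in>I. X x y) = (\<Sum>(i, j, l)\<in>I. of_bool (y (i, j, l)) * (u i - u j))"
      by (rule sum.cong) (auto simp: X_def)
    also have "\<dots> = (\<Sum>(i, j)\<in>oriented E. wins L y i j * (u i - u j))"
      unfolding I_def sum_sample_indices wins_def by (rule sum.cong) (auto simp: sum_distrib_right)
    finally show ?thesis .
  qed
  have dev: "(\<Sum>(i, j)\<in>oriented E. (real L * logistic (\<theta>s i - \<theta>s j) - wins L y i j) * (u i - u j)) =
      (\<Sum>x\<in>I. measure_pmf.expectation P (X x)) - (\<Sum>x\<in>I. X x y)" for y
    unfolding mean total sum_subtractf[symmetric] by (rule sum.cong) (auto simp: left_diff_distrib)
  have "(b x - a x)\<^sup>2 = (case x of (i, j, l) \<Rightarrow> (u i - u j)\<^sup>2)" for x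
    by (auto simp: a_def b_def min_def max_def power2_commute split: prod.split)
  then have "(\<Sum>x\<in>I. (b x - a x)\<^sup>2) = (\<Sum>(i, j, l)\<in>I. (u i - u j)\<^sup>2)" by simp
  also have "\<dots> = real L * energy (oriented E) u"
    unfolding I_def sum_sample_indices energy_def sum_distrib_left by (rule sum.cong) auto
  finally have width: "(\<Sum>x\<in>I. (b x - a x)\<^sup>2) = real L * energy (oriented E) u" .
  show ?thesis
  proof (cases "real L * energy (oriented E) u = 0")
    case True
    have "(u i - u j) * real L = 0" if "(i, j) \<in> oriented E" for i j
      using True square_le_energy[OF fin that, of u] by auto
    then have z: "real L = 0 \<or> (\<forall>(i, j)\<in>oriented E. u i - u j = 0)" by auto
    have "(\<Sum>(i, j)\<in>oriented E. (real L * logistic (\<theta>s i - \<theta>s j) - wins L y i j) * (u i - u j)) = 0" for y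
      using z by (intro sum.neutral) (auto simp: wins_def)
    then show ?thesis using t by simp
  next
    case False
    then have pos: "0 < real L * energy (oriented E) u"
      using mult_nonneg_nonneg[OF of_nat_0_le_iff energy_nonneg, of L "oriented E" u] by linarith
    have "measure_pmf.prob P {y. t < \<bar>(\<Sum>x\<in>I. measure_pmf.expectation P (X x)) - (\<Sum>x\<in>I. X x y)\<bar>} \<le>
        measure_pmf.prob P {y \<in> space (measure_pmf P). t \<le> \<bar>(\<Sum>x\<in>I. X x y) - (\<Sum>x\<in>I. measure_pmf.expectation P (X x))\<bar>}"
    proof (rule measure_pmf.finite_measure_mono)
      have "t \<le> \<bar>b' - a'\<bar>" if "t < \<bar>a' - b'\<bar>" for a' b' :: real
        using that by linarith
      then show "{y. t < \<bar>(\<Sum>x\<in>I. measure_pmf.expectation P (X x)) - (\<Sum>x\<in>I. X x y)\<bar>} \<subseteq>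
          {y \<in> space (measure_pmf P). t \<le> \<bar>(\<Sum>x\<in>I. X x y) - (\<Sum>x\<in>I. measure_pmf.expectation P (X x))\<bar>}"
        by simp blast
    qed simp
    also have "\<dots> \<le> 2 * exp (- 2 * t\<^sup>2 / (\<Sum>x\<in>I. (b x - a x)\<^sup>2))"
      by (rule H.Hoeffding_ineq_abs_ge[OF t]) (use pos width in simp)
    also have "\<dots> \<le> 2 * exp (- q)"
    proof -
      have s0: "0 < s" using pos s by simp
      have "q \<le> 2 * t\<^sup>2 / s" using q s0 by (simp add: field_simps)
      also have "\<dots> \<le> 2 * t\<^sup>2 / (real L * energy (oriented E) u)"
        using s pos s0 by (intro divide_left_mono) auto
      finally show ?thesis by (simp add: width)
    qed
    finally show ?thesis unfolding dev P_def by simp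
  qed
qed

text \<open>Subtracting the mean \<mu> centers the critical point without changing differences. The
  likelihood lies above its tangent there, strictly as soon as one edge difference changes, and one
  does change because a centered vector is determined by its edge differences.\<close>

lemma mle_from_critical_point:
  assumes net: "network n (oriented E) R" and L: "1 \<le> L"
    and crit: "\<And>v. (\<Sum>(i, j)\<in>oriented E. (real L * logistic (\<theta>s i - \<theta>s j + (d i - d j)) - wins L y i j) * (v i - v j)) = 0"
    and bound: "\<And>k l. k \<in> {1..n} \<Longrightarrow> l \<in> {1..n} \<Longrightarrow> \<bar>d k - d l\<bar> \<le> B"
  shows "mle_error_le n E (\<lambda>_ _. L) \<theta>s B y"
proof -
  interpret network n "oriented E" R by (rule net)
  define N where "N = neg_log_likelihood E (\<lambda>_ _. L) y"
  define \<mu> where "\<mu> = (\<Sum>i=1..n. \<theta>s i + d i) / real n"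
  define \<theta> where "\<theta> = (\<lambda>i\<in>{1..n}. \<theta>s i + d i - \<mu>)"
  have \<theta>: "\<theta> \<in> centered_vectors n"
    using n_pos by (auto simp: centered_vectors_def \<theta>_def \<mu>_def sum_subtractf)
  have \<theta>_diff: "\<theta> i - \<theta> j = \<theta>s i - \<theta>s j + (d i - d j)" if "i \<in> {1..n}" "j \<in> {1..n}" for i j
    using that by (simp add: \<theta>_def)
  have strict: "N \<theta> < N \<theta>'" if \<theta>': "\<theta>' \<in> centered_vectors n" and ne: "\<theta>' \<noteq> \<theta>" for \<theta>'
  proof -
    have "\<exists>(i, j)\<in>oriented E. \<theta>' i - \<theta>' j \<noteq> \<theta> i - \<theta> j"
    proof (rule ccontr)
      assume "\<not> ?thesis"
      then have "energy (oriented E) (\<lambda>i. \<theta>' i - \<theta> i) = 0"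
        unfolding energy_def by (intro sum.neutral) (auto simp: algebra_simps)
      then have const: "\<theta>' k - \<theta> k = \<theta>' 1 - \<theta> 1" if "k \<in> {1..n}" for k
        using diff_le[OF that, of 1 "\<lambda>i. \<theta>' i - \<theta> i"] n_pos by auto
      have "(\<Sum>k=1..n. \<theta>' k - \<theta> k) = real n * (\<theta>' 1 - \<theta> 1)"
        using sum.cong[OF refl const, of "{1..n}" "\<lambda>k. k"] by simp
      moreover have "(\<Sum>k=1..n. \<theta>' k - \<theta> k) = 0"
        using \<theta> \<theta>' by (simp add: centered_vectors_def sum_subtractf)
      ultimately have z: "\<theta>' k = \<theta> k" if "k \<in> {1..n}" for k
        using n_pos const[OF that] by simp
      have "\<theta>' = \<theta>"
        by (rule PiE_ext[where k = "{1..n}" and s = "\<lambda>_. UNIV"])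
           (use \<theta> \<theta>' z in \<open>auto simp: centered_vectors_def\<close>)
      with ne show False by simp
    qed
    then obtain i0 j0 where e0: "(i0, j0) \<in> oriented E" "\<theta>' i0 - \<theta>' j0 \<noteq> \<theta> i0 - \<theta> j0" by auto
    define g where "g = (\<lambda>(i, j) x::real. real L * ln (1 + exp x) - wins L y i j * x)"
    define s where "s = (\<lambda>(i, j). (real L * logistic (\<theta> i - \<theta> j) - wins L y i j) * ((\<theta>' i - \<theta>' j) - (\<theta> i - \<theta> j)))"
    have lt: "g (i, j) (\<theta> i - \<theta> j) + s (i, j) < g (i, j) (\<theta>' i - \<theta>' j)" if "\<theta>' i - \<theta>' j \<noteq> \<theta> i - \<theta> j" for i j
      using mult_strict_left_mono[OF softplus_strict_convex[OF that[symmetric]], of "real L"] L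
      by (simp add: g_def s_def algebra_simps)
    have le: "g (i, j) (\<theta> i - \<theta> j) + s (i, j) \<le> g (i, j) (\<theta>' i - \<theta>' j)" for i j
      using lt[of i j] by (cases "\<theta>' i - \<theta>' j = \<theta> i - \<theta> j") (auto simp: s_def)
    have N: "N \<psi> = (\<Sum>(i, j)\<in>oriented E. g (i, j) (\<psi> i - \<psi> j))" for \<psi>
      unfolding N_def neg_log_likelihood_eq g_def by simp
    \<comment> \<open>The tangent terms add up to a directional derivative at the critical
      point.\<close>
    have "(\<Sum>e\<in>oriented E. s e) = (\<Sum>(i, j)\<in>oriented E. (real L * logistic (\<theta>s i - \<theta>s j + (d i - d j)) - wins L y i j) *
        ((\<theta>' i - \<theta> i) - (\<theta>' j - \<theta> j)))"
      by (rule sum.cong) (auto simp: s_def \<theta>_diff dest!: edge_nodes)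
    also have "\<dots> = 0" by (rule crit)
    finally have "N \<theta> = (\<Sum>(i, j)\<in>oriented E. g (i, j) (\<theta> i - \<theta> j) + s (i, j))"
      unfolding N case_prod_beta sum.distrib by simp
    also have "\<dots> < N \<theta>'"
      unfolding N
      by (rule sum_strict_mono_ex1[OF finite_edges]) (use le lt[OF e0(2)] e0(1) in \<open>auto intro!: bexI[of _ "(i0, j0)"]\<close>)
    finally show ?thesis .
  qed
  have mle: "is_mle n E (\<lambda>_ _. L) y \<theta>' \<longleftrightarrow> \<theta>' = \<theta>" for \<theta>'
  proof
    assume "is_mle n E (\<lambda>_ _. L) y \<theta>'"
    then show "\<theta>' = \<theta>" using strict[of \<theta>'] \<theta> by (auto simp: is_mle_def is_arg_min_def N_def)
  next
    assume "\<theta>' = \<theta>"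
    then show "is_mle n E (\<lambda>_ _. L) y \<theta>'"
      using strict \<theta> unfolding is_mle_def is_arg_min_def N_def by (metis less_asym less_irrefl)
  qed
  show ?thesis
    unfolding mle_error_le_def mle using bound by (auto simp: \<theta>_diff)
qed

text \<open>The noise bound is needed for all n^2 ordered pairs. Hoeffding with exponent 2 \<tau>
  lets each pair fail with probability at most 2 (\<delta> / n)^2, so some pair fails with
  probability at most 2 \<delta>^2, which is below \<delta> as \<delta> < 1/2.\<close>

lemma mle_error_probability:
  fixes \<delta> :: real
  assumes model: "btl_model n E \<theta>s \<kappa> \<kappa>E" and \<delta>: "0 < \<delta>" "\<delta> < 1 / 2" and L: "1 \<le> L"
    and Q: "0 \<le> Q" "\<And>i j. (i, j) \<in> E \<Longrightarrow> has_resistance (oriented E) i j Q"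
    and R: "0 \<le> R" "\<And>k l. k \<in> {1..n} \<Longrightarrow> l \<in> {1..n} \<Longrightarrow> has_resistance (oriented E) k l R"
    and size: "256 * \<kappa>E ^ 4 * Q\<^sup>2 * real (card (oriented E)) * ln (real n / \<delta>) \<le> real L"
    and B: "8 * \<kappa>E * sqrt R * sqrt (ln (real n / \<delta>) / real L) \<le> B"
  shows "1 - \<delta> \<le> measure_pmf.prob (btl_samples E (\<lambda>_ _. L) \<theta>s) {y. mle_error_le n E (\<lambda>_ _. L) \<theta>s B y}"
proof -
  \<comment> \<open>Both bounds hold on an edge. The minimum is at most Q there, as the box
    requires, and at most R everywhere, as the final error bound requires.\<close>
  define r where "r = (\<lambda>k l. if (k, l) \<in> E then min Q R else R)"
  define \<tau> where "\<tau> = ln (real n / \<delta>)"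
  have n: "1 \<le> n" and E: "E \<subseteq> {1..n} \<times> {1..n}" and k1: "1 \<le> \<kappa>E"
    using model by (auto simp: btl_model_def connected_graph_def)
  have r: "0 \<le> r k l" "r k l \<le> R" for k l using Q(1) R(1) by (auto simp: r_def)
  have tau: "0 \<le> \<tau>" using n \<delta> by (auto simp: \<tau>_def)
  interpret btl_network n "oriented E" r \<theta>s \<kappa>E L
  proof unfold_locales
    show "oriented E \<subseteq> {1..n} \<times> {1..n}" using E by (auto simp: oriented_def)
    show "has_resistance (oriented E) k l (r k l)" if "k \<in> {1..n}" "l \<in> {1..n}" for k l
      using that Q(2)[of k l] R(2)[of k l] by (auto simp: r_def min_def)
    show "\<bar>\<theta>s i - \<theta>s j\<bar> \<le> ln \<kappa>E" if "(i, j) \<in> oriented E" for i j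
      using that model by (auto simp: oriented_def btl_model_def)
  qed (use n r k1 L in auto)
  define P where "P = btl_samples E (\<lambda>_ _. L) \<theta>s"
  define bad where "bad = (\<lambda>(k, l). {y. 4 * \<kappa>E * sqrt (r k l) * sqrt (\<tau> / real L) <
    \<bar>\<Sum>(i, j)\<in>oriented E. (real L * logistic (\<theta>s i - \<theta>s j) - wins L y i j) * (potential k l i - potential k l j)\<bar>})"
  define good where "good = {y. mle_error_le n E (\<lambda>_ _. L) \<theta>s B y}"
  have bad_le: "measure_pmf.prob P (bad (k, l)) \<le> 2 * exp (- (2 * \<tau>))" if kl: "k \<in> {1..n}" "l \<in> {1..n}" for k l
    unfolding bad_def P_def prod.case
  proof (rule noise_tail[where s = "16 * \<kappa>E\<^sup>2 * r k l / real L"])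
    show "real L * energy (oriented E) (potential k l) \<le> 16 * \<kappa>E\<^sup>2 * r k l / real L"
      using mult_left_mono[OF energy_potential[OF kl], of "real L"] L by (simp add: power2_eq_square)
    show "16 * \<kappa>E\<^sup>2 * r k l / real L * (2 * \<tau>) \<le> 2 * (4 * \<kappa>E * sqrt (r k l) * sqrt (\<tau> / real L))\<^sup>2"
      using tau r by (simp add: power_mult_distrib)
  qed (use finite_edges k1 r tau in auto)
  have "UNIV - (\<Union>e\<in>{1..n} \<times> {1..n}. bad e) \<subseteq> good"
  proof
    fix y assume y: "y \<in> UNIV - (\<Union>e\<in>{1..n} \<times> {1..n}. bad e)"
    obtain d where d:
      "\<And>v. (\<Sum>(i, j)\<in>oriented E. (real L * logistic (\<theta>s i - \<theta>s j + (d i - d j)) - wins L y i j) * (v i - v j)) = 0"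
      "\<And>k l. k \<in> {1..n} \<Longrightarrow> l \<in> {1..n} \<Longrightarrow>
        \<bar>d k - d l\<bar> \<le> 8 * \<kappa>E * sqrt (r k l) * sqrt (\<tau> / real L)"
    proof (rule critical_point[OF tau Q(1), where c = "wins L y"])
      show "r i j \<le> Q" if "(i, j) \<in> oriented E" for i j using that by (simp add: r_def oriented_def)
      show "256 * \<kappa>E ^ 4 * Q\<^sup>2 * real (card (oriented E)) * \<tau> \<le> real L" using size by (simp add: \<tau>_def)
      show "\<bar>\<Sum>(i, j)\<in>oriented E. (real L * logistic (\<theta>s i - \<theta>s j) - wins L y i j) * (potential k l i - potential k l j)\<bar>
        \<le> 4 * \<kappa>E * sqrt (r k l) * sqrt (\<tau> / real L)" if "k \<in> {1..n}" "l \<in> {1..n}" for k l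
        using y that by (force simp: bad_def not_less)
    qed blast
    have "\<bar>d k - d l\<bar> \<le> B" if "k \<in> {1..n}" "l \<in> {1..n}" for k l
    proof -
      have "\<bar>d k - d l\<bar> \<le> 8 * \<kappa>E * sqrt (r k l) * sqrt (\<tau> / real L)" by (rule d(2)[OF that])
      also have "\<dots> \<le> 8 * \<kappa>E * sqrt R * sqrt (\<tau> / real L)"
        using k1 r tau by (intro mult_right_mono mult_left_mono) auto
      finally show ?thesis using B by (simp add: \<tau>_def)
    qed
    then show "y \<in> good"
      unfolding good_def using mle_from_critical_point[OF network_axioms L d(1)] by simp
  qed
  then have "measure_pmf.prob P (UNIV - (\<Union>e\<in>{1..n} \<times> {1..n}. bad e)) \<le> measure_pmf.prob P good"
    by (intro measure_pmf.finite_measure_mono) auto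
  moreover have "measure_pmf.prob P (UNIV - (\<Union>e\<in>{1..n} \<times> {1..n}. bad e)) =
      1 - measure_pmf.prob P (\<Union>e\<in>{1..n} \<times> {1..n}. bad e)"
    using measure_pmf.prob_compl[of "\<Union>e\<in>{1..n} \<times> {1..n}. bad e" P] by simp
  moreover have "measure_pmf.prob P (\<Union>e\<in>{1..n} \<times> {1..n}. bad e) \<le> \<delta>"
  proof -
    have "measure_pmf.prob P (\<Union>e\<in>{1..n} \<times> {1..n}. bad e) \<le> (\<Sum>e\<in>{1..n} \<times> {1..n}. measure_pmf.prob P (bad e))"
      by (intro measure_pmf.finite_measure_subadditive_finite) auto
    also have "\<dots> \<le> (\<Sum>e\<in>{1..n} \<times> {1..n}. 2 * exp (- (2 * \<tau>)))"
      by (rule sum_mono) (use bad_le in auto)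
    also have "exp (- (2 * \<tau>)) = (\<delta> / real n)\<^sup>2"
    proof -
      have "exp (- (2 * \<tau>)) = exp (- \<tau>) * exp (- \<tau>)" by (simp add: exp_add[symmetric])
      also have "exp (- \<tau>) = \<delta> / real n"
        using n \<delta> by (simp add: \<tau>_def exp_minus)
      finally show ?thesis by (simp add: power2_eq_square)
    qed
    also have "(\<Sum>e\<in>{1..n} \<times> {1..n}. 2 * (\<delta> / real n)\<^sup>2) = 2 * \<delta> * \<delta>"
      using n by (simp add: card_cartesian_product power2_eq_square)
    also have "\<dots> \<le> \<delta>" using mult_right_mono[of "2 * \<delta>" 1 \<delta>] \<delta> by simp
    finally show ?thesis .
  qed
  ultimately show ?thesis unfolding P_def good_def by linarith
qed

section \<open>Effective resistance of the grids\<close>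

lemma has_resistance_mono:
  assumes "has_resistance A k l R" "R \<le> R'"
  shows "has_resistance A k l R'"
  unfolding has_resistance_def
proof
  fix f
  have "(f k - f l)\<^sup>2 \<le> R * energy A f" using assms(1) by (simp add: has_resistance_def)
  also have "\<dots> \<le> R' * energy A f" by (intro mult_right_mono assms energy_nonneg)
  finally show "(f k - f l)\<^sup>2 \<le> R' * energy A f" .
qed

lemma energy_mono: "finite A \<Longrightarrow> B \<subseteq> A \<Longrightarrow> energy B f \<le> energy A f"
  unfolding energy_def by (intro sum_mono2) auto

lemma energy_diff_Id: "finite A \<Longrightarrow> energy (A - Id) f = energy A f"
  unfolding energy_def by (intro sum.mono_neutral_left) auto

lemma energy_image: "inj_on g A \<Longrightarrow> energy (g ` A) f = (\<Sum>x\<in>A. (f (fst (g x)) - f (snd (g x)))\<^sup>2)"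
  by (simp add: energy_def sum.reindex case_prod_beta)

section \<open>Averages over blocks of nodes\<close>

definition avg :: "'a set \<Rightarrow> ('a \<Rightarrow> real) \<Rightarrow> real" where
  "avg S f = (\<Sum>x\<in>S. f x) / real (card S)"

lemma avg_singleton [simp]: "avg {k} f = f k"
  by (simp add: avg_def)

lemma avg_diff_square_le:
  assumes "finite S" "S \<noteq> {}" "finite T" "T \<noteq> {}"
  shows "(avg S f - avg T f)\<^sup>2 \<le> energy (S \<times> T) f / (real (card S) * real (card T))"
proof -
  define N where "N = real (card S) * real (card T)"
  have cards: "0 < real (card S)" "0 < real (card T)"
    using assms by (auto simp: card_gt_0_iff)
  then have N: "0 < N" by (simp add: N_def)
  define D where "D = (\<Sum>p\<in>S \<times> T. f (fst p) - f (snd p))"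
  have "D = (\<Sum>x\<in>S. \<Sum>y\<in>T. f x - f y)"
    by (simp add: D_def sum.cartesian_product case_prod_beta)
  also have "\<dots> = real (card T) * (\<Sum>x\<in>S. f x) - real (card S) * (\<Sum>y\<in>T. f y)"
    by (simp add: sum_subtractf sum_distrib_left)
  also have "\<dots> = N * (avg S f - avg T f)"
    using cards by (simp add: avg_def N_def field_simps)
  finally have "(N * (avg S f - avg T f))\<^sup>2 = D\<^sup>2" by simp
  also have "D\<^sup>2 \<le> energy (S \<times> T) f * N"
    unfolding D_def energy_def N_def of_nat_mult[symmetric] card_cartesian_product[symmetric]
      case_prod_beta
    by (rule sum_squared_le_sum_of_squares)
  finally have "N * (N * (avg S f - avg T f)\<^sup>2) \<le> N * energy (S \<times> T) f"
    by (simp add: power_mult_distrib power2_eq_square mult_ac)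
  then have "N * (avg S f - avg T f)\<^sup>2 \<le> energy (S \<times> T) f" using N by simp
  then show ?thesis
    unfolding N_def[symmetric] using N by (simp add: pos_le_divide_eq mult.commute)
qed

text \<open>Coarse graining: the b^2 pairs between two completely joined blocks act in parallel like
  one edge of conductance b^2. Disjoint blocks use disjoint sets of pairs, so no part of the energy
  of A is charged twice.\<close>

lemma energy_coarse_le:
  assumes A: "finite A" and C: "finite C" "\<And>i j. (i, j) \<in> C \<Longrightarrow> B i \<times> B j \<subseteq> A"
    and card: "\<And>i j. (i, j) \<in> C \<Longrightarrow> card (B i) = b \<and> card (B j) = b" "0 < b"
    and disj: "\<And>i j. B i \<inter> B j \<noteq> {} \<Longrightarrow> i = j"
  shows "energy C (\<lambda>i. avg (B i) f) \<le> energy A f / (real b)\<^sup>2"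
proof -
  have fin: "finite (B i) \<and> finite (B j) \<and> B i \<noteq> {} \<and> B j \<noteq> {}" if "(i, j) \<in> C" for i j
    using card(1)[OF that] card(2) by (metis card.empty card.infinite less_irrefl)
  have "energy C (\<lambda>i. avg (B i) f) \<le> (\<Sum>(i, j)\<in>C. energy (B i \<times> B j) f / (real b)\<^sup>2)"
    unfolding energy_def[of C]
  proof (rule sum_mono, clarify)
    fix i j assume ij: "(i, j) \<in> C"
    then show "(avg (B i) f - avg (B j) f)\<^sup>2 \<le> energy (B i \<times> B j) f / (real b)\<^sup>2"
      using avg_diff_square_le[of "B i" "B j" f] fin[OF ij] card(1)[OF ij]
      by (simp add: power2_eq_square)
  qed
  also have "\<dots> = (\<Sum>p\<in>C. energy (B (fst p) \<times> B (snd p)) f) / (real b)\<^sup>2"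
    by (simp add: sum_divide_distrib case_prod_beta)
  also have "(\<Sum>p\<in>C. energy (B (fst p) \<times> B (snd p)) f) = energy (\<Union>p\<in>C. B (fst p) \<times> B (snd p)) f"
    unfolding energy_def
  proof (rule sum.UNION_disjoint[symmetric])
    show "\<forall>p\<in>C. finite (B (fst p) \<times> B (snd p))" using fin by auto
    show "\<forall>p\<in>C. \<forall>q\<in>C. p \<noteq> q \<longrightarrow> B (fst p) \<times> B (snd p) \<inter> B (fst q) \<times> B (snd q) = {}"
      using disj by (auto simp: prod_eq_iff)
  qed (rule C)
  also have "\<dots> \<le> energy A f"
    by (intro energy_mono A UN_least C(2)) simp
  finally show ?thesis by (simp add: divide_right_mono)
qed

lemma square_sum3_le: "(x + y + z)\<^sup>2 \<le> 3 * (x\<^sup>2 + y\<^sup>2 + (z::real)\<^sup>2)"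
  using sum_squares_ge_zero[of "x - y" "y - z"] zero_le_square[of "x - z"]
  by (simp add: power2_eq_square algebra_simps)

lemma square_sum2_le: "(x + y)\<^sup>2 \<le> 2 * (x\<^sup>2 + (y::real)\<^sup>2)"
  using zero_le_square[of "x - y"] by (simp add: power2_eq_square algebra_simps)

text \<open>Three legs, from k to the average over S, on to that over T, and out to l; the factor 3
  comes from squaring their sum. A node may lie in its own block, so A must then contain a diagonal
  pair; this is why the balls below keep the diagonal.\<close>

lemma has_resistance_via_blocks:
  assumes A: "finite A" "{k} \<times> S \<subseteq> A" "{l} \<times> T \<subseteq> A"
    and b: "card S = b" "card T = b" "0 < b"
    and avg: "\<And>f. (avg S f - avg T f)\<^sup>2 \<le> \<rho> * energy A f"
  shows "has_resistance A k l (3 * (2 / real b + \<rho>))"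
  unfolding has_resistance_def
proof
  fix f
  have near: "(f x - avg U f)\<^sup>2 \<le> energy A f / real b" if "{x} \<times> U \<subseteq> A" "card U = b" for x U
  proof -
    have "finite U" "U \<noteq> {}" using that b by (metis card.infinite less_irrefl, auto)
    then have "(f x - avg U f)\<^sup>2 \<le> energy ({x} \<times> U) f / real b"
      using avg_diff_square_le[of "{x}" U f] that by simp
    also have "\<dots> \<le> energy A f / real b"
      by (intro divide_right_mono energy_mono A that) auto
    finally show ?thesis .
  qed
  have "(f k - f l)\<^sup>2 = ((f k - avg S f) + (avg S f - avg T f) + (avg T f - f l))\<^sup>2" by simp
  also have "\<dots> \<le> 3 * ((f k - avg S f)\<^sup>2 + (avg S f - avg T f)\<^sup>2 + (avg T f - f l)\<^sup>2)"
    by (rule square_sum3_le)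
  also have "\<dots> \<le> 3 * (energy A f / real b + \<rho> * energy A f + energy A f / real b)"
    using near[OF A(2) b(1)] near[OF A(3) b(2)] avg[of f]
    by (simp add: power2_commute[of "avg T f"])
  also have "\<dots> = 3 * (2 / real b + \<rho>) * energy A f" by (simp add: algebra_simps)
  finally show "(f k - f l)\<^sup>2 \<le> 3 * (2 / real b + \<rho>) * energy A f" .
qed

text \<open>The grids are symmetric, so their energy counts each edge twice, whereas the likelihood
  runs over i < j. This is the source of the factor 2.\<close>

lemma oriented_resistance:
  fixes A :: "(nat \<times> nat) set"
  assumes A: "finite A" "sym A" "irrefl A" and R: "has_resistance A k l R"
  shows "has_resistance {(i, j). (i, j) \<in> A \<and> i < j} k l (2 * R)"
proof -
  define W where "W = {(i, j). (i, j) \<in> A \<and> i < j}"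
  have split: "A = W \<union> prod.swap ` W"
    using A(2,3) by (auto simp: W_def image_iff sym_def irrefl_def) (metis linorder_neqE_nat)+
  have fin: "finite W" by (rule finite_subset[OF _ A(1)]) (auto simp: W_def)
  have "energy A f = 2 * energy W f" for f
  proof -
    have "energy A f = energy W f + energy (prod.swap ` W) f"
      unfolding energy_def by (subst split, rule sum.union_disjoint) (use fin in \<open>auto simp: W_def\<close>)
    also have "energy (prod.swap ` W) f = energy W f"
      unfolding energy_def
      by (subst sum.reindex) (auto simp: case_prod_beta power2_commute intro!: sum.cong)
    finally show ?thesis by simp
  qed
  then show ?thesis
    using R by (simp add: has_resistance_def W_def[symmetric] mult_ac)
qed

lemma path_square_le:
  fixes F :: "nat \<Rightarrow> real"
  assumes "a \<le> b"
  shows "(F b - F a)\<^sup>2 \<le> real (b - a) * (\<Sum>i=a..<b. (F i - F (Suc i))\<^sup>2)"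
proof -
  have "(F b - F a)\<^sup>2 = (\<Sum>i=a..<b. F (Suc i) - F i)\<^sup>2"
    by (simp add: sum_Suc_diff'[OF assms])
  also have "\<dots> \<le> (\<Sum>i=a..<b. (F (Suc i) - F i)\<^sup>2) * real (card {a..<b})"
    by (rule sum_squared_le_sum_of_squares)
  finally show ?thesis by (simp add: mult.commute power2_commute)
qed

section \<open>Division of a segment into blocks of equal length\<close>

locale blocks =
  fixes m s :: nat
  assumes s_pos: "1 \<le> s" and s_le: "s \<le> m"
begin

definition M :: nat where "M = m div s"

definition blk :: "nat \<Rightarrow> nat set" where "blk a = {a * s + 1..a * s + s}"

text \<open>Fewer than s nodes at the end may fill no block; the minimum assigns them to the last
  full one.\<close>

definition idx :: "nat \<Rightarrow> nat" where "idx k = min ((k - 1) div s) (M - 1)"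

lemma M_pos: "1 \<le> M"
  using s_pos s_le by (simp add: M_def div_greater_zero_iff Suc_le_eq)

lemma M_mult_le: "M * s \<le> m" by (simp add: M_def)

lemma blk_subset: "a < M \<Longrightarrow> blk a \<subseteq> {1..m}"
proof -
  assume "a < M"
  then have "(a + 1) * s \<le> M * s" by (intro mult_right_mono) auto
  then show ?thesis using M_mult_le by (auto simp: blk_def)
qed

lemma card_blk: "card (blk a) = s" by (simp add: blk_def)

lemma blk_index: "x \<in> blk a \<Longrightarrow> (x - 1) div s = a"
proof -
  assume "x \<in> blk a"
  then have "x - 1 = a * s + (x - 1 - a * s)" "x - 1 - a * s < s" by (auto simp: blk_def)
  then show ?thesis using s_pos
    by (metis add.right_neutral div_less div_mult_self3 not_one_le_zero)
qed

lemma blk_disjoint: "blk a \<inter> blk b \<noteq> {} \<Longrightarrow> a = b"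
  using blk_index by blast

lemma idx_less: "idx k < M" using M_pos by (simp add: idx_def)

lemma blk_same: "x \<in> blk a \<Longrightarrow> y \<in> blk a \<Longrightarrow> \<bar>real x - real y\<bar> \<le> real s - 1"
  by (auto simp: blk_def)

lemma blk_next: "x \<in> blk a \<Longrightarrow> y \<in> blk (Suc a) \<Longrightarrow> \<bar>real x - real y\<bar> \<le> 2 * real s - 1"
  by (auto simp: blk_def)

text \<open>Within its own block a node is at distance at most s - 1. The weaker bound accounts for
  a leftover node, which may be s - 1 beyond the end of the last full block.\<close>

lemma blk_near:
  assumes k: "k \<in> {1..m}" and y: "y \<in> blk (idx k)"
  shows "\<bar>real k - real y\<bar> \<le> 2 * real s - 2"
proof (cases "(k - 1) div s < M")
  case True
  then have "idx k = (k - 1) div s" by (simp add: idx_def)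
  moreover have "(k - 1) div s * s \<le> k - 1" by simp
  moreover have "k - 1 < s + (k - 1) div s * s" using s_pos by (intro dividend_less_div_times) auto
  ultimately have "idx k * s \<le> k - 1" "k - 1 < s + idx k * s" by auto
  then have "k \<in> blk (idx k)" using k unfolding blk_def atLeastAtMost_iff by linarith
  from blk_same[OF this y] show ?thesis using s_pos by simp
next
  case False
  then have "idx k = M - 1" by (simp add: idx_def)
  then have y': "(M - 1) * s + 1 \<le> y" "y \<le> (M - 1) * s + s" using y by (auto simp: blk_def)
  have e: "(M - 1) * s + s = M * s" using M_pos by (simp add: algebra_simps)
  have "M * s \<le> k - 1" using False s_pos by (simp add: not_less less_eq_div_iff_mult_less_eq)
  moreover have "m < M * s + s"
    using s_pos dividend_less_div_times[of s m] by (simp add: M_def add.commute)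
  ultimately show ?thesis using k y' e by auto
qed

text \<open>Rounding to blocks costs at most one block length. For r of the order of s, the ends of
  an edge are therefore boundedly many blocks apart.\<close>

lemma idx_dist: "real s * \<bar>real (idx k) - real (idx l)\<bar> \<le> \<bar>real k - real l\<bar> + real s"
proof -
  have *: "real s * \<bar>real (idx k) - real (idx l)\<bar> \<le> \<bar>real k - real l\<bar> + real s" if "k \<le> l" for k l
  proof -
    have le: "(k - 1) div s \<le> (l - 1) div s" using that by (intro div_le_mono) auto
    have "\<bar>real (idx k) - real (idx l)\<bar> \<le> real ((l - 1) div s) - real ((k - 1) div s)"
      using le by (auto simp: idx_def min_def)
    then have "real s * \<bar>real (idx k) - real (idx l)\<bar> \<le>
        real s * (real ((l - 1) div s) - real ((k - 1) div s))"
      by (intro mult_left_mono) auto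
    also have "\<dots> = real ((l - 1) div s * s) - real ((k - 1) div s * s)" by (simp add: algebra_simps)
    also have "\<dots> \<le> real (l - 1) - (real (k - 1) - real s)"
    proof -
      have "(l - 1) div s * s \<le> l - 1" by simp
      moreover have "k - 1 < s + (k - 1) div s * s"
        using s_pos by (intro dividend_less_div_times) auto
      ultimately show ?thesis by linarith
    qed
    also have "\<dots> \<le> \<bar>real k - real l\<bar> + real s" using that by (auto simp: of_nat_diff)
    finally show ?thesis .
  qed
  show ?thesis
    using *[of k l] *[of l k] by (cases "k \<le> l") (auto simp: abs_minus_commute)
qed

lemma idx_dist_le: "\<bar>real (idx k) - real (idx l)\<bar> \<le> real m / real s"
proof -
  have "\<bar>real (idx k) - real (idx l)\<bar> \<le> real M" using idx_less[of k] idx_less[of l] by linarith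
  also have "\<dots> \<le> real m / real s"
    using s_pos M_mult_le by (simp add: field_simps flip: of_nat_mult)
  finally show ?thesis .
qed

end

section \<open>Resistance of the one-dimensional grid\<close>

definition ball_1d :: "nat \<Rightarrow> real \<Rightarrow> (nat \<times> nat) set" where
  "ball_1d n r = {(i, j). i \<in> {1..n} \<and> j \<in> {1..n} \<and> \<bar>real i - real j\<bar> \<le> r}"

text \<open>Adjacent blocks are completely joined because their nodes are at most 2 s - 1 apart.
  This gives a path whose links have resistance 1 / s^2 each and are in series; the term 2 / s pays
  for the legs between the two nodes and their blocks.\<close>

lemma resistance_ball_1d:
  assumes bl: "blocks n s" and r: "2 * real s - 1 \<le> r" and k: "k \<in> {1..n}" and l: "l \<in> {1..n}"
  shows "has_resistance (ball_1d n r) k l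
    (3 * (2 / real s + \<bar>real (blocks.idx n s k) - real (blocks.idx n s l)\<bar> / (real s)\<^sup>2))"
proof -
  interpret blocks n s by (rule bl)
  define A where "A = ball_1d n r"
  have A: "finite A" by (rule finite_subset[of _ "{1..n} \<times> {1..n}"]) (auto simp: A_def ball_1d_def)
  define C where "C = (\<lambda>i. (i, Suc i)) ` {..<M - 1}"
  have coarse: "energy C (\<lambda>i. avg (blk i) f) \<le> energy A f / (real s)\<^sup>2" for f
  proof (rule energy_coarse_le[OF A])
    show "blk i \<times> blk j \<subseteq> A" if "(i, j) \<in> C" for i j
    proof clarify
      fix x y assume xy: "x \<in> blk i" "y \<in> blk j"
      have "i < M" "j = Suc i" "j < M" using that by (auto simp: C_def)
      then show "(x, y) \<in> A"
        using blk_subset[of i] blk_subset[of j] xy blk_next[of x i y] r by (auto simp: A_def ball_1d_def)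
    qed
  qed (use s_pos blk_disjoint in \<open>auto simp: C_def card_blk\<close>)
  have path: "(F a - F b)\<^sup>2 \<le> \<bar>real a - real b\<bar> * energy C F" if "a < M" "b < M" for a b F
  proof -
    have *: "(F a - F b)\<^sup>2 \<le> \<bar>real a - real b\<bar> * energy C F" if "a \<le> b" "b < M" for a b
    proof -
      have "(F b - F a)\<^sup>2 \<le> real (b - a) * (\<Sum>i=a..<b. (F i - F (Suc i))\<^sup>2)"
        by (rule path_square_le[OF that(1)])
      also have "(\<Sum>i=a..<b. (F i - F (Suc i))\<^sup>2) = energy ((\<lambda>i. (i, Suc i)) ` {a..<b}) F"
        by (subst energy_image) (auto simp: inj_on_def)
      also have "\<dots> \<le> energy C F"
        unfolding C_def using that by (intro energy_mono image_mono) auto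
      finally show ?thesis using that(1) by (simp add: power2_commute of_nat_diff mult_left_mono)
    qed
    show ?thesis
      using *[of a b] *[of b a] that by (cases "a \<le> b") (auto simp: power2_commute abs_minus_commute)
  qed
  show ?thesis
    unfolding A_def[symmetric]
  proof (rule has_resistance_via_blocks[OF A])
    show "{k} \<times> blk (idx k) \<subseteq> A" "{l} \<times> blk (idx l) \<subseteq> A"
      using blk_near[OF k] blk_near[OF l] blk_subset[OF idx_less, of k] blk_subset[OF idx_less, of l] k l r
      by (force simp: A_def ball_1d_def)+
    fix f
    have "(avg (blk (idx k)) f - avg (blk (idx l)) f)\<^sup>2 \<le>
        \<bar>real (idx k) - real (idx l)\<bar> * energy C (\<lambda>i. avg (blk i) f)"
      by (rule path[OF idx_less idx_less])
    also have "\<dots> \<le> \<bar>real (idx k) - real (idx l)\<bar> * (energy A f / (real s)\<^sup>2)"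
      by (intro mult_left_mono coarse) auto
    finally show "(avg (blk (idx k)) f - avg (blk (idx l)) f)\<^sup>2 \<le>
        \<bar>real (idx k) - real (idx l)\<bar> / (real s)\<^sup>2 * energy A f" by simp
  qed (use s_pos card_blk in auto)
qed

lemma energy_grid_1d: "energy (grid_1d n r) f = energy (ball_1d n r) f"
proof -
  have "grid_1d n r = ball_1d n r - Id" by (auto simp: grid_1d_def ball_1d_def)
  moreover have "finite (ball_1d n r)"
    by (rule finite_subset[of _ "{1..n} \<times> {1..n}"]) (auto simp: ball_1d_def)
  ultimately show ?thesis by (simp add: energy_diff_Id)
qed

text \<open>Blocks should have side about r / c. For small r rounding down could give zero, and
  blocks of a single node take over; for them the distances to be covered are at most 1, so 1 \<le>
  r suffices even if \<open>c * real s \<le> r\<close> fails.\<close>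

lemma block_size:
  fixes r c :: real
  assumes "1 \<le> r" "1 \<le> c"
  defines "s \<equiv> max 1 (nat \<lfloor>r / c\<rfloor>)"
  shows "1 \<le> s" "r \<le> 2 * c * real s" "s = 1 \<or> c * real s \<le> r"
proof -
  show "1 \<le> s" by (simp add: s_def)
  have "r / c < real (nat \<lfloor>r / c\<rfloor>) + 1" by linarith
  also have "\<dots> \<le> 2 * real s" unfolding s_def by linarith
  finally show "r \<le> 2 * c * real s" using assms by (simp add: field_simps)
  show "s = 1 \<or> c * real s \<le> r"
  proof (cases "nat \<lfloor>r / c\<rfloor> \<le> 1")
    case False
    then have "real s \<le> r / c" by (simp add: s_def max_def) linarith
    then show ?thesis using assms by (simp add: field_simps)
  qed (auto simp: s_def)
qed

text \<open>Blocks of length about r / 2 give 1 / s \<le> 4 / r. Any two nodes are at most n / s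
  blocks apart, whence n / s^3 and 3 * 64 = 192; the ends of an edge are at most 5 blocks apart,
  whence 3 * (2 + 5) * 4 = 84. The bound r \<le> n ensures that a block fits into the
  segment.\<close>

lemma resistance_grid_1d:
  assumes r: "1 \<le> r" "r \<le> real n" and k: "k \<in> {1..n}" and l: "l \<in> {1..n}"
  shows "has_resistance (grid_1d n r) k l (192 * ((real n / r\<^sup>2 + 1) / r))"
    and "(k, l) \<in> grid_1d n r \<Longrightarrow> has_resistance (grid_1d n r) k l (84 / r)"
proof -
  define s where "s = max 1 (nat \<lfloor>r / 2\<rfloor>)"
  have s: "1 \<le> s" "r \<le> 4 * real s" "s = 1 \<or> 2 * real s \<le> r"
    using block_size[of r 2] r by (auto simp: s_def)
  have s_le: "s \<le> n" using s(1,3) r by linarith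
  interpret blocks n s by unfold_locales (use s s_le in auto)
  have s0: "0 < real s" and r0: "0 < r" using s r by auto
  have inv_s: "1 / real s \<le> 4 / r" using s(2) s0 r0 by (simp add: field_simps)
  have "2 * real s - 1 \<le> r" using s(3) r by auto
  note R = resistance_ball_1d[OF blocks_axioms this k l]
  define D where "D = \<bar>real (idx k) - real (idx l)\<bar>"
  have tr: "has_resistance (ball_1d n r) k l \<rho> \<Longrightarrow> has_resistance (grid_1d n r) k l \<rho>" for \<rho>
    by (simp add: has_resistance_def energy_grid_1d)
  have "3 * (2 / real s + D / (real s)\<^sup>2) \<le> 192 * ((real n / r\<^sup>2 + 1) / r)"
  proof -
    have "D / (real s)\<^sup>2 \<le> real n / real s / (real s)\<^sup>2"
      unfolding D_def by (intro divide_right_mono idx_dist_le) auto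
    also have "\<dots> = real n * (1 / real s) ^ 3" by (simp add: power2_eq_square power3_eq_cube)
    also have "\<dots> \<le> real n * (4 / r) ^ 3" using inv_s s0 by (intro mult_left_mono power_mono) auto
    also have "\<dots> = 64 * (real n / r ^ 3)" by (simp add: power_divide)
    finally have "3 * (2 / real s + D / (real s)\<^sup>2) \<le> 3 * (2 * (4 / r) + 64 * (real n / r ^ 3))"
      using inv_s by simp
    also have "\<dots> \<le> 192 * (real n / r ^ 3) + 192 * (1 / r)" using r0 by (simp add: field_simps)
    also have "\<dots> = 192 * ((real n / r\<^sup>2 + 1) / r)"
      by (simp add: add_divide_distrib power2_eq_square power3_eq_cube)
    finally show ?thesis .
  qed
  from has_resistance_mono[OF R[folded D_def] this]
  show "has_resistance (grid_1d n r) k l (192 * ((real n / r\<^sup>2 + 1) / r))" by (rule tr)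
  assume "(k, l) \<in> grid_1d n r"
  then have "\<bar>real k - real l\<bar> \<le> r" by (simp add: grid_1d_def)
  then have "real s * D \<le> real s * 5" using idx_dist[of k l] s(2) by (simp add: D_def)
  then have D5: "D \<le> 5" using s0 by simp
  have "D / (real s)\<^sup>2 \<le> 5 / (real s)\<^sup>2" using D5 by (intro divide_right_mono) auto
  also have "\<dots> \<le> 5 / real s" using s(1) s0 by (intro divide_left_mono) (auto simp: power2_eq_square)
  finally have "3 * (2 / real s + D / (real s)\<^sup>2) \<le> 21 * (1 / real s)" by simp
  also have "\<dots> \<le> 84 / r" using inv_s by simp
  finally have "3 * (2 / real s + D / (real s)\<^sup>2) \<le> 84 / r" .
  from has_resistance_mono[OF R[folded D_def] this]
  show "has_resistance (grid_1d n r) k l (84 / r)" by (rule tr)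
qed

section \<open>Logarithmic resistance of the square lattice\<close>

lemma harm_le_ln: "1 \<le> n \<Longrightarrow> harm n \<le> 1 + ln (real n)"
proof (induction n rule: dec_induct)
  case (step n)
  have n: "0 < real n" using step by simp
  have "ln (real n / real (Suc n)) \<le> real n / real (Suc n) - 1"
    using n by (intro ln_le_minus_one) simp
  also have "\<dots> = - inverse (real (Suc n))" by (simp add: field_simps)
  finally have "inverse (real (Suc n)) \<le> ln (real (Suc n)) - ln (real n)"
    using n by (simp add: ln_div)
  then show ?case using step by (simp add: harm_Suc)
qed (simp add: harm_def)

text \<open>Summation by parts: it expresses the excess of a new last entry over the average of the
  earlier ones through consecutive differences.\<close>

lemma sum_telescope_weighted:
  fixes g :: "nat \<Rightarrow> real"
  shows "(\<Sum>y\<le>t. real (Suc y) * (g (Suc y) - g y)) = real (Suc t) * g (Suc t) - (\<Sum>y\<le>t. g y)"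
  by (induction t) (simp_all add: algebra_simps)

text \<open>The averages over two consecutive columns of the triangle differ by a flow in which each edge
  carries at most \<open>1 / (t + 1)\<close>; hence the harmonic sum below.\<close>

lemma column_average_step:
  fixes G :: "nat \<Rightarrow> nat \<Rightarrow> real"
  defines "b \<equiv> \<lambda>t. (\<Sum>y\<le>t. G t y) / real (Suc t)"
  shows "(b (Suc t) - b t)\<^sup>2 \<le> 2 / real (Suc t) *
    (\<Sum>y\<le>t. (G (Suc t) y - G t y)\<^sup>2 + (G (Suc t) (Suc y) - G (Suc t) y)\<^sup>2)"
proof -
  define T where "T = real (Suc t)"
  have T: "0 < T" by (simp add: T_def)
  \<comment> \<open>An intermediate average splits the step in two: horizontally from column t to
    the first t + 1 entries of the next column, then vertically to the whole of that column.\<close>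
  define c where "c = (\<Sum>y\<le>t. G (Suc t) y) / T"
  have "(c - b t)\<^sup>2 = (\<Sum>y\<le>t. G (Suc t) y - G t y)\<^sup>2 / T\<^sup>2"
    by (simp add: c_def b_def T_def sum_subtractf power_divide flip: diff_divide_distrib)
  also have "\<dots> \<le> ((\<Sum>y\<le>t. (G (Suc t) y - G t y)\<^sup>2) * T) / T\<^sup>2"
    using sum_squared_le_sum_of_squares[of "\<lambda>y. G (Suc t) y - G t y" "{..t}"]
    by (intro divide_right_mono) (auto simp: T_def)
  also have "\<dots> = (\<Sum>y\<le>t. (G (Suc t) y - G t y)\<^sup>2) / T" using T by (simp add: power2_eq_square)
  finally have h: "(c - b t)\<^sup>2 \<le> (\<Sum>y\<le>t. (G (Suc t) y - G t y)\<^sup>2) / T" .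
  define a where "a = (\<lambda>y. real (Suc y) / (T * (T + 1)))"
  have "b (Suc t) - c = (T * G (Suc t) (Suc t) - (\<Sum>y\<le>t. G (Suc t) y)) / (T * (T + 1))"
  proof -
    have "b (Suc t) = ((\<Sum>y\<le>t. G (Suc t) y) + G (Suc t) (Suc t)) / (T + 1)"
      by (simp add: b_def T_def add.commute)
    moreover have "(x + z) / (T + 1) - x / T = (T * z - x) / (T * (T + 1))" for x z
      using T by (simp add: diff_frac_eq algebra_simps)
    ultimately show ?thesis by (simp add: c_def)
  qed
  also have "T * G (Suc t) (Suc t) - (\<Sum>y\<le>t. G (Suc t) y) =
      (\<Sum>y\<le>t. real (Suc y) * (G (Suc t) (Suc y) - G (Suc t) y))"
    unfolding T_def by (rule sum_telescope_weighted[symmetric])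
  finally have "b (Suc t) - c = (\<Sum>y\<le>t. a y * (G (Suc t) (Suc y) - G (Suc t) y))"
    by (simp add: a_def sum_divide_distrib)
  then have "(b (Suc t) - c)\<^sup>2 \<le> (\<Sum>y\<le>t. (a y)\<^sup>2) * (\<Sum>y\<le>t. (G (Suc t) (Suc y) - G (Suc t) y)\<^sup>2)"
    by (simp add: Cauchy_Schwarz_ineq_sum)
  also have "\<dots> \<le> 1 / T * (\<Sum>y\<le>t. (G (Suc t) (Suc y) - G (Suc t) y)\<^sup>2)"
  proof (rule mult_right_mono)
    have "(a y)\<^sup>2 \<le> (1 / T)\<^sup>2" if "y \<le> t" for y
    proof (rule power_mono)
      have "real (Suc y) \<le> T + 1" using that by (simp add: T_def)
      then have "real (Suc y) / (T + 1) / T \<le> 1 / T" using T by (intro divide_right_mono) auto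
      then show "a y \<le> 1 / T" by (simp only: a_def divide_divide_eq_left mult.commute)
      show "0 \<le> a y" using T by (simp add: a_def)
    qed
    then have "(\<Sum>y\<le>t. (a y)\<^sup>2) \<le> (\<Sum>y\<le>t. (1 / T)\<^sup>2)" by (intro sum_mono) auto
    also have "\<dots> = T * (1 / T)\<^sup>2" by (simp add: T_def)
    also have "\<dots> = 1 / T" using T by (simp add: power2_eq_square)
    finally show "(\<Sum>y\<le>t. (a y)\<^sup>2) \<le> 1 / T" .
  qed (intro sum_nonneg, auto)
  finally have v: "(b (Suc t) - c)\<^sup>2 \<le> (\<Sum>y\<le>t. (G (Suc t) (Suc y) - G (Suc t) y)\<^sup>2) / T" by simp
  have "(b (Suc t) - b t)\<^sup>2 \<le> 2 * ((c - b t)\<^sup>2 + (b (Suc t) - c)\<^sup>2)"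
    using square_sum2_le[of "c - b t" "b (Suc t) - c"] by simp
  also have "\<dots> \<le> 2 * ((\<Sum>y\<le>t. (G (Suc t) y - G t y)\<^sup>2) / T +
      (\<Sum>y\<le>t. (G (Suc t) (Suc y) - G (Suc t) y)\<^sup>2) / T)"
    using h v by simp
  finally show ?thesis by (simp add: T_def sum.distrib distrib_left)
qed

text \<open>Resistances in series: the step from column t to the next costs 2 / (t + 1).
  Cauchy--Schwarz with weights adapted to these costs adds them up to a harmonic sum, while every
  edge of the triangle is charged only once.\<close>

lemma triangle_square_le:
  fixes G :: "nat \<Rightarrow> nat \<Rightarrow> real"
  shows "(G 0 0 - (\<Sum>y\<le>h. G h y) / real (Suc h))\<^sup>2 \<le> 2 * harm h *
    (\<Sum>t<h. \<Sum>y\<le>t. (G (Suc t) y - G t y)\<^sup>2 + (G (Suc t) (Suc y) - G (Suc t) y)\<^sup>2)"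
proof -
  define b where "b = (\<lambda>t. (\<Sum>y\<le>t. G t y) / real (Suc t))"
  define e where "e = (\<lambda>t. \<Sum>y\<le>t. (G (Suc t) y - G t y)\<^sup>2 + (G (Suc t) (Suc y) - G (Suc t) y)\<^sup>2)"
  define d where "d = (\<lambda>t. b (Suc t) - b t)"
  define w where "w = (\<lambda>t. sqrt (2 / real (Suc t)))"
  have w: "0 < w t" "(w t)\<^sup>2 = 2 / real (Suc t)" for t by (simp_all add: w_def)
  have d: "(d t / w t)\<^sup>2 \<le> e t" for t
  proof -
    have "(d t)\<^sup>2 \<le> (w t)\<^sup>2 * e t"
      unfolding d_def b_def e_def w by (rule column_average_step)
    then show ?thesis using w(1)[of t] by (simp add: power_divide pos_divide_le_eq mult.commute)
  qed
  have "(b h - b 0)\<^sup>2 = (\<Sum>t<h. w t * (d t / w t))\<^sup>2"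
    using w(1) by (simp add: d_def sum_lessThan_telescope less_imp_neq[THEN not_sym])
  also have "\<dots> \<le> (\<Sum>t<h. (w t)\<^sup>2) * (\<Sum>t<h. (d t / w t)\<^sup>2)"
    by (rule Cauchy_Schwarz_ineq_sum)
  also have "\<dots> \<le> (\<Sum>t<h. (w t)\<^sup>2) * (\<Sum>t<h. e t)"
    by (intro mult_left_mono sum_mono d sum_nonneg) auto
  also have "(\<Sum>t<h. (w t)\<^sup>2) = 2 * harm h"
  proof -
    have "(\<Sum>t<h. (w t)\<^sup>2) = (\<Sum>t<h. 2 * inverse (real (Suc t)))"
      unfolding w by (simp add: field_simps)
    also have "\<dots> = 2 * harm h"
      by (induction h) (simp_all add: harm_def harm_Suc)
    finally show ?thesis .
  qed
  finally show ?thesis by (simp add: b_def e_def power2_commute)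
qed

definition lattice :: "nat \<Rightarrow> ((nat \<times> nat) \<times> (nat \<times> nat)) set" where
  "lattice M = {(p, q). p \<in> {..<M} \<times> {..<M} \<and> q \<in> {..<M} \<times> {..<M} \<and>
     \<bar>int (fst p) - int (fst q)\<bar> + \<bar>int (snd p) - int (snd q)\<bar> = 1}"

lemma finite_lattice: "finite (lattice M)"
  by (rule finite_subset[of _ "({..<M} \<times> {..<M}) \<times> ({..<M} \<times> {..<M})"]) (auto simp: lattice_def)

lemma energy_lattice_swap: "energy (lattice M) (F \<circ> prod.swap) = energy (lattice M) F"
proof -
  have inj: "inj_on (map_prod prod.swap prod.swap) (lattice M)"
    by (auto simp: inj_on_def)
  have "lattice M = map_prod prod.swap prod.swap ` lattice M"
  proof
    show "lattice M \<subseteq> map_prod prod.swap prod.swap ` lattice M"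
    proof clarify
      fix a b c d assume "((a, b), (c, d)) \<in> lattice M"
      then have "((b, a), (d, c)) \<in> lattice M" by (auto simp: lattice_def)
      then show "((a, b), (c, d)) \<in> map_prod prod.swap prod.swap ` lattice M" by force
    qed
  qed (auto simp: lattice_def)
  then have "energy (lattice M) F = energy (map_prod prod.swap prod.swap ` lattice M) F" by simp
  also have "\<dots> = energy (lattice M) (F \<circ> prod.swap)"
    unfolding energy_image[OF inj] by (simp add: energy_def case_prod_beta)
  finally show ?thesis ..
qed

lemma lattice_row_path:
  assumes "a < M" "b < M" "y < M"
  shows "(F (a, y) - F (b, y))\<^sup>2 \<le> \<bar>real a - real b\<bar> * energy (lattice M) F"
proof -
  have *: "(F (a, y) - F (b, y))\<^sup>2 \<le> \<bar>real a - real b\<bar> * energy (lattice M) F"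
    if "a \<le> b" "b < M" for a b
  proof -
    have "(F (b, y) - F (a, y))\<^sup>2 \<le> real (b - a) * (\<Sum>i=a..<b. (F (i, y) - F (Suc i, y))\<^sup>2)"
      by (rule path_square_le[OF that(1), of "\<lambda>i. F (i, y)"])
    also have "(\<Sum>i=a..<b. (F (i, y) - F (Suc i, y))\<^sup>2) =
        energy ((\<lambda>i. ((i, y), (Suc i, y))) ` {a..<b}) F"
      by (subst energy_image) (auto simp: inj_on_def)
    also have "\<dots> \<le> energy (lattice M) F"
      using that assms by (intro energy_mono finite_lattice) (auto simp: lattice_def)
    finally show ?thesis using that(1) by (simp add: power2_commute of_nat_diff mult_left_mono)
  qed
  show ?thesis
    using *[of a b] *[of b a] assms
    by (cases "a \<le> b") (auto simp: power2_commute abs_minus_commute)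
qed

text \<open>Straight segments with h steps, in either direction. Used as coordinates of a triangle
  they let one statement cover all its reflections.\<close>

definition unit_speed :: "nat \<Rightarrow> nat \<Rightarrow> (nat \<Rightarrow> nat) \<Rightarrow> bool" where
  "unit_speed M h u \<longleftrightarrow> inj_on u {..h} \<and> (\<forall>t\<le>h. u t < M) \<and>
     (\<forall>t<h. \<bar>int (u (Suc t)) - int (u t)\<bar> = 1)"

text \<open>The coordinates map the horizontal edges of the triangle injectively into the lattice,
  and likewise the vertical ones. Each of the two families costs at most the full energy, which
  turns the factor 2 into 4.\<close>

lemma lattice_triangle:
  assumes u: "unit_speed M h u" and v: "unit_speed M h v"
  shows "(F (u 0, v 0) - (\<Sum>y\<le>h. F (u h, v y)) / real (Suc h))\<^sup>2 \<le> 4 * harm h * energy (lattice M) F"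
proof -
  define S where "S = Sigma {..<h} (\<lambda>t. {..t})"
  have uD: "u t < M" if "t \<le> h" for t using u that by (simp add: unit_speed_def)
  have vD: "v t < M" if "t \<le> h" for t using v that by (simp add: unit_speed_def)
  have u1: "\<bar>int (u (Suc t)) - int (u t)\<bar> = 1" if "t < h" for t using u that by (simp add: unit_speed_def)
  have v1: "\<bar>int (v (Suc t)) - int (v t)\<bar> = 1" if "t < h" for t using v that by (simp add: unit_speed_def)
  have ui: "u t = u t' \<longleftrightarrow> t = t'" if "t \<le> h" "t' \<le> h" for t t'
    using u that by (auto simp: unit_speed_def inj_on_def)
  have vi: "v t = v t' \<longleftrightarrow> t = t'" if "t \<le> h" "t' \<le> h" for t t'
    using v that by (auto simp: unit_speed_def inj_on_def)
  have H: "(\<Sum>t<h. \<Sum>y\<le>t. (F (u (Suc t), v y) - F (u t, v y))\<^sup>2) \<le> energy (lattice M) F"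
  proof -
    define g where "g = (\<lambda>p. ((u (Suc (fst p)), v (snd p)), (u (fst p), v (snd p))))"
    have inj: "inj_on g S" unfolding g_def S_def by (rule inj_onI) (auto simp: ui vi)
    have "(\<Sum>t<h. \<Sum>y\<le>t. (F (u (Suc t), v y) - F (u t, v y))\<^sup>2) = energy (g ` S) F"
      unfolding energy_image[OF inj] by (simp add: S_def sum.Sigma g_def case_prod_beta)
    also have "\<dots> \<le> energy (lattice M) F"
      by (intro energy_mono finite_lattice) (auto simp: g_def S_def lattice_def uD vD u1)
    finally show ?thesis .
  qed
  have V: "(\<Sum>t<h. \<Sum>y\<le>t. (F (u (Suc t), v (Suc y)) - F (u (Suc t), v y))\<^sup>2) \<le> energy (lattice M) F"
  proof -
    define g where "g = (\<lambda>p. ((u (Suc (fst p)), v (Suc (snd p))), (u (Suc (fst p)), v (snd p))))"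
    have inj: "inj_on g S" unfolding g_def S_def by (rule inj_onI) (auto simp: ui vi)
    have "(\<Sum>t<h. \<Sum>y\<le>t. (F (u (Suc t), v (Suc y)) - F (u (Suc t), v y))\<^sup>2) = energy (g ` S) F"
      unfolding energy_image[OF inj] by (simp add: S_def sum.Sigma g_def case_prod_beta)
    also have "\<dots> \<le> energy (lattice M) F"
      by (intro energy_mono finite_lattice) (auto simp: g_def S_def lattice_def uD vD v1)
    finally show ?thesis .
  qed
  have "(F (u 0, v 0) - (\<Sum>y\<le>h. F (u h, v y)) / real (Suc h))\<^sup>2 \<le> 2 * harm h *
      (\<Sum>t<h. \<Sum>y\<le>t. (F (u (Suc t), v y) - F (u t, v y))\<^sup>2 + (F (u (Suc t), v (Suc y)) - F (u (Suc t), v y))\<^sup>2)"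
    by (rule triangle_square_le[of "\<lambda>t y. F (u t, v y)"])
  also have "\<dots> \<le> 2 * harm h * (energy (lattice M) F + energy (lattice M) F)"
    unfolding sum.distrib by (intro mult_left_mono add_mono H V) (simp add: harm_nonneg)
  finally show ?thesis by simp
qed

text \<open>Two mirror-image triangles with apexes at the ends of the segment share the column
  through its midpoint and are compared via the average there. They open upwards if h more rows fit
  and downwards otherwise; 2 h < M leaves room for one of the two. The constant is 2 * (4 +
  4).\<close>

lemma lattice_row_even:
  assumes a: "a + 2 * h < M" and y: "y < M"
  shows "(F (a, y) - F (a + 2 * h, y))\<^sup>2 \<le> 16 * harm h * energy (lattice M) F"
proof -
  obtain v where v: "unit_speed M h v" "v 0 = y"
  proof (cases "y + h < M")
    case True
    show thesis by (rule that[of "\<lambda>t. y + t"]) (use True in \<open>auto simp: unit_speed_def inj_on_def\<close>)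
  next
    case False
    show thesis by (rule that[of "\<lambda>t. y - t"]) (use False a y in \<open>auto simp: unit_speed_def inj_on_def\<close>)
  qed
  have u1: "unit_speed M h (\<lambda>t. a + t)" and u2: "unit_speed M h (\<lambda>t. a + 2 * h - t)"
    using a by (auto simp: unit_speed_def inj_on_def)
  define m where "m = (\<Sum>z\<le>h. F (a + h, v z)) / real (Suc h)"
  have "(F (a, y) - m)\<^sup>2 \<le> 4 * harm h * energy (lattice M) F"
    using lattice_triangle[OF u1 v(1), of F] by (simp add: v(2) m_def add.commute)
  moreover have "(F (a + 2 * h, y) - m)\<^sup>2 \<le> 4 * harm h * energy (lattice M) F"
    using lattice_triangle[OF u2 v(1), of F] by (simp add: v(2) m_def add.commute)
  moreover have "(F (a, y) - F (a + 2 * h, y))\<^sup>2 \<le> 2 * ((F (a, y) - m)\<^sup>2 + (m - F (a + 2 * h, y))\<^sup>2)"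
    using square_sum2_le[of "F (a, y) - m" "m - F (a + 2 * h, y)"] by simp
  ultimately show ?thesis by (simp add: power2_commute[of m])
qed

text \<open>An odd distance has no middle column. One lattice edge is spent to make it even, which
  gives 2 * (1 + 16 * harm M).\<close>

lemma lattice_row_log:
  assumes "a < M" "b < M" "y < M"
  shows "(F (a, y) - F (b, y))\<^sup>2 \<le> (2 + 32 * harm M) * energy (lattice M) F"
proof -
  define E where "E = energy (lattice M) F"
  have E: "0 \<le> E" by (simp add: E_def energy_nonneg)
  have even: "(F (a, y) - F (a + 2 * h, y))\<^sup>2 \<le> 16 * harm M * E" if "a + 2 * h < M" for a h
  proof -
    have "harm h \<le> (harm M :: real)" using that by (intro harm_mono) auto
    then show ?thesis
      using lattice_row_even[OF that assms(3), of F] E mult_right_mono[of "harm h" "harm M" E]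
      by (simp add: E_def)
  qed
  have *: "(F (a, y) - F (b, y))\<^sup>2 \<le> (2 + 32 * harm M) * E" if "a \<le> b" "b < M" for a b
  proof (cases "even (b - a)")
    case True
    then obtain h where h: "b - a = 2 * h" by blast
    then have "b = a + 2 * h" using that by simp
    then have "(F (a, y) - F (b, y))\<^sup>2 \<le> 16 * harm M * E" using even[of a h] that by simp
    also have "\<dots> \<le> (2 + 32 * harm M) * E"
      using E harm_nonneg[of M, where 'a = real] by (intro mult_right_mono) auto
    finally show ?thesis .
  next
    case False
    then obtain h where h: "b - a = 2 * h + 1" by (rule oddE)
    then have b: "b = Suc a + 2 * h" using that by simp
    have "(F (a, y) - F (Suc a, y))\<^sup>2 \<le> \<bar>real a - real (Suc a)\<bar> * E"
      unfolding E_def using that b assms by (intro lattice_row_path) auto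
    moreover have "(F (Suc a, y) - F (b, y))\<^sup>2 \<le> 16 * harm M * E"
      using even[of "Suc a" h] that b by simp
    moreover have "(F (a, y) - F (b, y))\<^sup>2 \<le> 2 * ((F (a, y) - F (Suc a, y))\<^sup>2 + (F (Suc a, y) - F (b, y))\<^sup>2)"
      using square_sum2_le[of "F (a, y) - F (Suc a, y)" "F (Suc a, y) - F (b, y)"] by simp
    ultimately show ?thesis by (simp add: algebra_simps)
  qed
  show ?thesis
    unfolding E_def[symmetric] using *[of a b] *[of b a] assms
    by (cases "a \<le> b") (auto simp: power2_commute)
qed

text \<open>The route turns at (b, y). Its column leg is a row bound for the reflected function,
  which has the same energy; hence \<open>cols\<close> also speaks of a row.\<close>

lemma lattice_two_legs:
  assumes rows: "\<And>F. (F (a, y) - F (b, y))\<^sup>2 \<le> \<rho> * energy (lattice M) F"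
    and cols: "\<And>F. (F (y, b) - F (z, b))\<^sup>2 \<le> \<rho>' * energy (lattice M) F"
  shows "(F (a, y) - F (b, z))\<^sup>2 \<le> 2 * (\<rho> + \<rho>') * energy (lattice M) F"
proof -
  have "(F (b, y) - F (b, z))\<^sup>2 \<le> \<rho>' * energy (lattice M) F"
    using cols[of "F \<circ> prod.swap"] by (simp add: energy_lattice_swap)
  then show ?thesis
    using rows[of F] square_sum2_le[of "F (a, y) - F (b, y)" "F (b, y) - F (b, z)"]
    by (simp add: algebra_simps)
qed

section \<open>Resistance of the two-dimensional grid\<close>

definition ball_2d :: "nat \<Rightarrow> real \<Rightarrow> ((nat \<times> nat) \<times> (nat \<times> nat)) set" where
  "ball_2d m r = {(p, q). p \<in> {1..m} \<times> {1..m} \<and> q \<in> {1..m} \<times> {1..m} \<and>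
     \<bar>real (fst p) - real (fst q)\<bar> + \<bar>real (snd p) - real (snd q)\<bar> \<le> r}"

text \<open>Points of adjacent square blocks are at l1 distance at most (2 s - 1) + (s - 1) = 3 s -
  2, and a node is within 2 * (2 s - 2) of all points of its block. Either hypothesis on s brings
  both below r. Blocks have s^2 nodes, so an edge of the lattice of blocks has conductance
  s^4.\<close>

lemma resistance_ball_2d:
  assumes bl: "blocks m s" and r: "s = 1 \<or> 4 * real s \<le> r" "1 \<le> r"
    and k: "k \<in> {1..m} \<times> {1..m}" and l: "l \<in> {1..m} \<times> {1..m}" and rho: "0 \<le> \<rho>"
    and coarse: "\<And>F. (F (blocks.idx m s (fst k), blocks.idx m s (snd k)) -
      F (blocks.idx m s (fst l), blocks.idx m s (snd l)))\<^sup>2 \<le> \<rho> * energy (lattice (blocks.M m s)) F"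
  shows "has_resistance (ball_2d m r) k l (3 * (2 / (real s)\<^sup>2 + \<rho> / (real s) ^ 4))"
proof -
  interpret blocks m s by (rule bl)
  define A where "A = ball_2d m r"
  have A: "finite A"
    by (rule finite_subset[of _ "({1..m} \<times> {1..m}) \<times> ({1..m} \<times> {1..m})"]) (auto simp: A_def ball_2d_def)
  have r1: "3 * real s - 2 \<le> r" and r2: "4 * real s - 4 \<le> r" using r s_pos by auto
  define B where "B = (\<lambda>p. blk (fst p) \<times> blk (snd p))"
  define J where "J = (\<lambda>p. (idx (fst p), idx (snd p)))"
  have cardB: "card (B p) = s * s" for p by (simp add: B_def card_cartesian_product card_blk)
  have Bm: "B p \<subseteq> {1..m} \<times> {1..m}" if "p \<in> {..<M} \<times> {..<M}" for p
    unfolding B_def using that by (intro Sigma_mono blk_subset) auto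
  have adj: "\<bar>real x - real y\<bar> \<le> (real s - 1) + real s * of_int \<bar>int a - int b\<bar>"
    if "x \<in> blk a" "y \<in> blk b" "\<bar>int a - int b\<bar> \<le> 1" for x y a b
  proof -
    have "a = b \<or> b = Suc a \<or> a = Suc b" using that(3) by linarith
    then show ?thesis
      using that blk_same[of x a y] blk_next[of x a y] blk_next[of y b x] by (auto simp: abs_minus_commute)
  qed
  have en: "energy (lattice M) (\<lambda>p. avg (B p) f) \<le> energy A f / (real (s * s))\<^sup>2" for f
  proof (rule energy_coarse_le[OF A finite_lattice])
    show "B p \<times> B q \<subseteq> A" if pq: "(p, q) \<in> lattice M" for p q
    proof (rule subsetI)
      fix e assume "e \<in> B p \<times> B q"
      then obtain x y where e: "e = (x, y)" "x \<in> B p" "y \<in> B q" by auto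
      have "\<bar>int (fst p) - int (fst q)\<bar> + \<bar>int (snd p) - int (snd q)\<bar> = 1"
        using pq by (simp add: lattice_def case_prod_beta)
      then have d: "\<bar>int (fst p) - int (fst q)\<bar> \<le> 1" "\<bar>int (snd p) - int (snd q)\<bar> \<le> 1"
        "real_of_int \<bar>int (fst p) - int (fst q)\<bar> + real_of_int \<bar>int (snd p) - int (snd q)\<bar> = 1"
        by linarith+
      have "\<bar>real (fst x) - real (fst y)\<bar> + \<bar>real (snd x) - real (snd y)\<bar> \<le>
          ((real s - 1) + real s * of_int \<bar>int (fst p) - int (fst q)\<bar>) +
          ((real s - 1) + real s * of_int \<bar>int (snd p) - int (snd q)\<bar>)"
        using e(2,3) d(1,2) by (intro add_mono adj) (auto simp: B_def)
      also have "\<dots> = 2 * (real s - 1) + real s *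
          (real_of_int \<bar>int (fst p) - int (fst q)\<bar> + real_of_int \<bar>int (snd p) - int (snd q)\<bar>)"
        by (simp only: algebra_simps)
      also have "\<dots> \<le> r" unfolding d(3) using r1 by simp
      finally have "\<bar>real (fst x) - real (fst y)\<bar> + \<bar>real (snd x) - real (snd y)\<bar> \<le> r" .
      moreover have "p \<in> {..<M} \<times> {..<M}" "q \<in> {..<M} \<times> {..<M}" using pq by (auto simp: lattice_def)
      ultimately show "e \<in> A" using e Bm[of p] Bm[of q] unfolding A_def ball_2d_def by blast
    qed
    show "p = q" if "B p \<inter> B q \<noteq> {}" for p q
      using that blk_disjoint by (auto simp: B_def prod_eq_iff)
  qed (use s_pos cardB in auto)
  have near: "{k} \<times> B (J k) \<subseteq> A" if k: "k \<in> {1..m} \<times> {1..m}" for k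
  proof
    fix e assume "e \<in> {k} \<times> B (J k)"
    then obtain y where e: "e = (k, y)" "y \<in> B (J k)" by auto
    have "\<bar>real (fst k) - real (fst y)\<bar> \<le> 2 * real s - 2" "\<bar>real (snd k) - real (snd y)\<bar> \<le> 2 * real s - 2"
      using e(2) k by (auto simp: B_def J_def intro!: blk_near)
    then have "\<bar>real (fst k) - real (fst y)\<bar> + \<bar>real (snd k) - real (snd y)\<bar> \<le> r" using r2 by linarith
    moreover have "J k \<in> {..<M} \<times> {..<M}" by (simp add: J_def idx_less)
    ultimately show "e \<in> A"
      using e k subsetD[OF Bm[of "J k"]] by (simp add: A_def ball_2d_def)
  qed
  have "has_resistance A k l (3 * (2 / real (s * s) + \<rho> / (real (s * s))\<^sup>2))"
  proof (rule has_resistance_via_blocks[OF A near[OF k] near[OF l] cardB cardB])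
    fix f
    have "(avg (B (J k)) f - avg (B (J l)) f)\<^sup>2 \<le> \<rho> * energy (lattice M) (\<lambda>p. avg (B p) f)"
      using coarse[of "\<lambda>p. avg (B p) f"] by (simp add: J_def)
    also have "\<dots> \<le> \<rho> * (energy A f / (real (s * s))\<^sup>2)"
      by (intro mult_left_mono en rho)
    finally show "(avg (B (J k)) f - avg (B (J l)) f)\<^sup>2 \<le> \<rho> / (real (s * s))\<^sup>2 * energy A f" by simp
  qed (use s_pos in auto)
  then show ?thesis unfolding A_def by (simp add: power2_eq_square power4_eq_xxxx mult.assoc)
qed

text \<open>Here 1 / s \<le> 8 / r. The first constant rounds up 3 * (2 * 64 + 136 * 4096), which
  exceeds the factor 3 * 128 * 4096 of the logarithm. The ends of an edge are at most 10 blocks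
  apart in total, so straight paths replace the triangles and avoid the logarithm: 3 * (2 + 20) * 64
  = 4224.\<close>

lemma resistance_ball_2d_bounds:
  assumes r: "1 \<le> r" "r \<le> 2 * real m" and k: "k \<in> {1..m} \<times> {1..m}" and l: "l \<in> {1..m} \<times> {1..m}"
  shows "has_resistance (ball_2d m r) k l (2000000 * ((ln (real (m\<^sup>2)) / r\<^sup>2 + 1) / r\<^sup>2))"
    and "(k, l) \<in> ball_2d m r \<Longrightarrow> has_resistance (ball_2d m r) k l (4224 / r\<^sup>2)"
proof -
  define s where "s = max 1 (nat \<lfloor>r / 4\<rfloor>)"
  have s: "1 \<le> s" "r \<le> 8 * real s" "s = 1 \<or> 4 * real s \<le> r"
    using block_size[of r 4] r by (auto simp: s_def)
  have m: "1 \<le> m" using k by auto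
  have s_le: "s \<le> m" using s(1,3) r m by linarith
  interpret blocks m s by unfold_locales (use s s_le in auto)
  have s0: "0 < real s" and r0: "0 < r" using s r by auto
  have inv_s: "1 / real s \<le> 8 / r" using s(2) s0 r0 by (simp add: field_simps)
  have inv_s2: "1 / (real s)\<^sup>2 \<le> 64 / r\<^sup>2"
    using power_mono[OF inv_s, of 2] s0 by (simp add: power_divide)
  have inv_s4: "1 / (real s) ^ 4 \<le> 4096 / r ^ 4"
    using power_mono[OF inv_s, of 4] s0 by (simp add: power_divide)
  note res = resistance_ball_2d[OF blocks_axioms s(3) r(1) k l]
  have less: "idx a < M" for a by (rule idx_less)
  define H where "H = 2 + 32 * (harm M :: real)"
  have H0: "0 \<le> H" using harm_nonneg[of M, where 'a = real] by (simp add: H_def)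
  have "has_resistance (ball_2d m r) k l (3 * (2 / (real s)\<^sup>2 + 2 * (H + H) / (real s) ^ 4))"
  proof (rule res)
    show "(F (idx (fst k), idx (snd k)) - F (idx (fst l), idx (snd l)))\<^sup>2 \<le> 2 * (H + H) * energy (lattice M) F" for F
      unfolding H_def by (intro lattice_two_legs lattice_row_log less)
  qed (use H0 in simp)
  moreover have "3 * (2 / (real s)\<^sup>2 + 2 * (H + H) / (real s) ^ 4) \<le>
      2000000 * ((ln (real (m\<^sup>2)) / r\<^sup>2 + 1) / r\<^sup>2)"
  proof -
    define g where "g = ln (real (m\<^sup>2))"
    have "M \<le> m" by (simp add: M_def)
    then have "ln (real M) \<le> ln (real m)" using M_pos by simp
    moreover have "g = 2 * ln (real m)" using m by (simp add: g_def ln_realpow)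
    moreover have "0 \<le> ln (real m)" using m by simp
    ultimately have lnM: "ln (real M) \<le> g" by linarith
    have "2 * (H + H) \<le> 136 + 128 * g"
      using harm_le_ln[OF M_pos] lnM by (simp add: H_def)
    then have le1: "2 * (H + H) / (real s) ^ 4 \<le> (136 + 128 * g) * (1 / (real s) ^ 4)"
      by (simp add: divide_right_mono)
    have g0: "0 \<le> g" using m by (simp add: g_def)
    define P where "P = 1 / r\<^sup>2"
    define P4 where "P4 = 1 / r ^ 4"
    have P4: "P4 \<le> P"
      unfolding P_def P4_def using r0 power_increasing[of 2 4 r, OF _ r(1)]
      by (intro divide_left_mono) auto
    have P4_eq: "P4 = P * P"
      unfolding P_def P4_def by (simp flip: power_add)
    then have P4_0: "0 \<le> P4" by simp
    have le2: "(136 + 128 * g) * (1 / (real s) ^ 4) \<le> (136 + 128 * g) * (4096 * P4)"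
      using inv_s4 g0 by (intro mult_left_mono) (auto simp: P4_def)
    have le3: "2 / (real s)\<^sup>2 \<le> 128 * P" using inv_s2 by (simp add: P_def)
    have "3 * (2 / (real s)\<^sup>2 + 2 * (H + H) / (real s) ^ 4) \<le>
        3 * (128 * P + (136 + 128 * g) * (4096 * P4))"
      by (intro mult_left_mono add_mono le3 order_trans[OF le1 le2]) simp
    also have "\<dots> = 384 * P + 1671168 * P4 + 1572864 * (g * P4)"
      by (simp add: algebra_simps)
    also have "\<dots> \<le> 2000000 * P + 2000000 * (g * P4)"
      using P4 mult_nonneg_nonneg[OF g0 P4_0] P4_0 by linarith
    also have "\<dots> = 2000000 * ((g / r\<^sup>2 + 1) / r\<^sup>2)"
      by (simp add: P4_eq) (simp add: P_def add_divide_distrib)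
    finally show ?thesis by (simp add: g_def)
  qed
  ultimately show "has_resistance (ball_2d m r) k l (2000000 * ((ln (real (m\<^sup>2)) / r\<^sup>2 + 1) / r\<^sup>2))"
    by (rule has_resistance_mono)
  assume "(k, l) \<in> ball_2d m r"
  then have kl: "\<bar>real (fst k) - real (fst l)\<bar> + \<bar>real (snd k) - real (snd l)\<bar> \<le> r"
    by (simp add: ball_2d_def case_prod_beta)
  define D1 where "D1 = \<bar>real (idx (fst k)) - real (idx (fst l))\<bar>"
  define D2 where "D2 = \<bar>real (idx (snd k)) - real (idx (snd l))\<bar>"
  have "real s * D1 \<le> \<bar>real (fst k) - real (fst l)\<bar> + real s"
    "real s * D2 \<le> \<bar>real (snd k) - real (snd l)\<bar> + real s"
    unfolding D1_def D2_def by (rule idx_dist)+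
  then have "real s * (D1 + D2) \<le> real s * 10" using kl s(2) by (simp add: distrib_left)
  then have D: "D1 + D2 \<le> 10" using s0 by simp
  have "has_resistance (ball_2d m r) k l (3 * (2 / (real s)\<^sup>2 + 2 * (D1 + D2) / (real s) ^ 4))"
  proof (rule res)
    show "(F (idx (fst k), idx (snd k)) - F (idx (fst l), idx (snd l)))\<^sup>2 \<le> 2 * (D1 + D2) * energy (lattice M) F" for F
      unfolding D1_def D2_def by (intro lattice_two_legs lattice_row_path less)
  qed (simp add: D1_def D2_def)
  moreover have "3 * (2 / (real s)\<^sup>2 + 2 * (D1 + D2) / (real s) ^ 4) \<le> 4224 / r\<^sup>2"
  proof -
    have "2 * (D1 + D2) / (real s) ^ 4 \<le> 20 / (real s) ^ 4" using D by (intro divide_right_mono) auto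
    also have "\<dots> \<le> 20 / (real s)\<^sup>2"
      using s0 power_increasing[of 2 4 "real s"] s(1) by (intro divide_left_mono) auto
    finally have "3 * (2 / (real s)\<^sup>2 + 2 * (D1 + D2) / (real s) ^ 4) \<le>
        3 * (2 / (real s)\<^sup>2 + 20 / (real s)\<^sup>2)"
      by (intro mult_left_mono add_left_mono) auto
    also have "\<dots> = 66 * (1 / (real s)\<^sup>2)" by simp
    also have "\<dots> \<le> 4224 / r\<^sup>2" using inv_s2 by simp
    finally show ?thesis .
  qed
  ultimately show "has_resistance (ball_2d m r) k l (4224 / r\<^sup>2)"
    by (rule has_resistance_mono)
qed

lemma has_resistance_grid_2d:
  assumes pos: "bij_betw pos {1..n} ({1..m} \<times> {1..m})" and k: "k \<in> {1..n}" and l: "l \<in> {1..n}"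
    and R: "has_resistance (ball_2d m r) (pos k) (pos l) R"
  shows "has_resistance (grid_2d n pos r) k l R"
proof -
  define D where "D = {(i, j). i \<in> {1..n} \<and> j \<in> {1..n} \<and> (pos i, pos j) \<in> ball_2d m r}"
  have inj: "inj_on pos {1..n}" and im: "pos ` {1..n} = {1..m} \<times> {1..m}"
    using pos by (auto simp: bij_betw_def)
  have mem: "pos i \<in> {1..m} \<times> {1..m}" if "i \<in> {1..n}" for i using im that by blast
  have fin: "finite D" by (rule finite_subset[of _ "{1..n} \<times> {1..n}"]) (auto simp: D_def)
  have grid: "grid_2d n pos r = D - Id"
    using mem by (auto simp: grid_2d_def D_def ball_2d_def)
  have ball: "ball_2d m r = map_prod pos pos ` D"
  proof
    show "ball_2d m r \<subseteq> map_prod pos pos ` D"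
    proof
      fix e assume e: "e \<in> ball_2d m r"
      then have "fst e \<in> pos ` {1..n}" "snd e \<in> pos ` {1..n}" unfolding im ball_2d_def by auto
      then obtain i j where "i \<in> {1..n}" "j \<in> {1..n}" "e = (pos i, pos j)"
        by (metis imageE prod.collapse)
      then show "e \<in> map_prod pos pos ` D" using e by (auto simp: D_def intro!: image_eqI[of _ _ "(i, j)"])
    qed
  qed (auto simp: D_def)
  have inj2: "inj_on (map_prod pos pos) D"
    by (rule inj_on_subset[OF map_prod_inj_on[OF inj inj]]) (auto simp: D_def)
  show ?thesis
    unfolding has_resistance_def
  proof
    fix f :: "nat \<Rightarrow> real"
    define F where "F = f \<circ> inv_into {1..n} pos"
    have F: "F (pos i) = f i" if "i \<in> {1..n}" for i
      using inj that by (simp add: F_def inv_into_f_f)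
    have "energy (ball_2d m r) F = energy D f"
      unfolding ball energy_image[OF inj2]
      by (auto simp: energy_def D_def F case_prod_beta intro!: sum.cong)
    also have "\<dots> = energy (grid_2d n pos r) f" by (simp add: grid energy_diff_Id[OF fin])
    finally show "(f k - f l)\<^sup>2 \<le> R * energy (grid_2d n pos r) f"
      using R F[OF k] F[OF l] unfolding has_resistance_def by metis
  qed
qed

section \<open>The error bounds\<close>

text \<open>This is how 1 \<le> r is obtained below: the two ends of an edge are at distance at
  least 1.\<close>

lemma connected_graph_edge:
  assumes "connected_graph n E" "2 \<le> n"
  obtains i j where "(i, j) \<in> E"
proof -
  have "(1, 2) \<in> E\<^sup>*" using assms by (auto simp: connected_graph_def)
  then show thesis using that by (cases rule: converse_rtranclE) auto
qed

lemma sample_size_ge: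
  fixes \<kappa> \<tau> :: real
  assumes "1 \<le> \<kappa>" "0 \<le> \<tau>" "0 < x" and L: "C * \<kappa> ^ 5 * n * \<tau> \<le> x * L" and "0 \<le> C" "0 \<le> n"
  shows "C * \<kappa> ^ 4 * n * \<tau> / x \<le> L"
proof -
  have "C * \<kappa> ^ 4 * n * \<tau> \<le> C * \<kappa> ^ 5 * n * \<tau>"
    using assms by (intro mult_right_mono mult_left_mono power_increasing) auto
  with L show ?thesis using assms(3) by (simp add: pos_divide_le_eq mult.commute)
qed

lemma error_bound_le:
  assumes "0 \<le> \<kappa>" "0 \<le> c" "8 * c \<le> C" "0 \<le> x" "0 \<le> \<tau>" "0 < y"
  shows "8 * \<kappa> * sqrt (c\<^sup>2 * (x / y)) * sqrt (\<tau> / real L) \<le> C * \<kappa> * sqrt (x * (1 / (y * real L)) * \<tau>)"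
proof -
  have "sqrt (c\<^sup>2 * (x / y)) * sqrt (\<tau> / real L) = c * sqrt (x * (1 / (y * real L)) * \<tau>)"
  proof -
    have "sqrt (x / y) * sqrt (\<tau> / real L) = sqrt (x * (1 / (y * real L)) * \<tau>)"
      unfolding real_sqrt_mult[symmetric] by (rule arg_cong[where f = sqrt]) simp
    then show ?thesis using assms(2) unfolding real_sqrt_mult[of "c\<^sup>2"] by simp
  qed
  then have "8 * \<kappa> * sqrt (c\<^sup>2 * (x / y)) * sqrt (\<tau> / real L) =
      (8 * c) * (\<kappa> * sqrt (x * (1 / (y * real L)) * \<tau>))" by simp
  also have "\<dots> \<le> C * (\<kappa> * sqrt (x * (1 / (y * real L)) * \<tau>))"
    using assms by (intro mult_right_mono) auto
  finally show ?thesis by simp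
qed

lemma oriented_grid_resistance:
  assumes "connected_graph n E" "has_resistance E k l R"
  shows "has_resistance (oriented E) k l (2 * R)"
proof -
  have "E \<subseteq> {1..n} \<times> {1..n}" using assms(1) by (simp add: connected_graph_def)
  then have "finite E" by (rule finite_subset) simp
  then show ?thesis
    unfolding oriented_def using assms by (intro oriented_resistance) (auto simp: connected_graph_def)
qed

text \<open>A single node leaves no edge from which 1 \<le> r could be read off, so this case is
  settled separately, with zero resistances.\<close>

lemma mle_error_probability_singleton:
  fixes \<delta> :: real
  assumes model: "btl_model 1 E \<theta>s \<kappa> \<kappa>E" and \<delta>: "0 < \<delta>" "\<delta> < 1 / 2" and L: "1 \<le> L" and B: "0 \<le> B"
  shows "1 - \<delta> \<le> measure_pmf.prob (btl_samples E (\<lambda>_ _. L) \<theta>s) {y. mle_error_le 1 E (\<lambda>_ _. L) \<theta>s B y}"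
proof (rule mle_error_probability[OF model \<delta> L, where Q = 0 and R = 0])
  have "E = {}" using model by (auto simp: btl_model_def connected_graph_def irrefl_def)
  then show "has_resistance (oriented E) i j 0" if "(i, j) \<in> E" for i j using that by simp
  show "has_resistance (oriented E) k l 0" if "k \<in> {1..1}" "l \<in> {1..1}" for k l
    using that by (simp add: has_resistance_def)
qed (use B in auto)

section \<open>Edge counts and choice of the constants\<close>

lemma card_oriented_grid_1d:
  assumes "1 \<le> r"
  shows "real (card (oriented (grid_1d n r))) \<le> real n * r"
proof -
  define K where "K = {1..n} \<times> {1..nat \<lfloor>r\<rfloor>}"
  define g where "g = (\<lambda>(i, j). (i, j - i :: nat))"
  have "inj_on g (oriented (grid_1d n r))"
    by (rule inj_onI) (auto simp: g_def oriented_def grid_1d_def)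
  moreover have "g ` oriented (grid_1d n r) \<subseteq> K"
  proof (rule image_subsetI)
    fix e assume "e \<in> oriented (grid_1d n r)"
    then obtain i j where e: "e = (i, j)" "(i, j) \<in> oriented (grid_1d n r)" by (cases e) auto
    then have ij: "i \<in> {1..n}" "i < j" "\<bar>real i - real j\<bar> \<le> r" by (auto simp: oriented_def grid_1d_def)
    then have "real (j - i) \<le> r" by (simp add: of_nat_diff)
    then have "j - i \<le> nat \<lfloor>r\<rfloor>" by (simp add: le_nat_floor)
    then show "g e \<in> K" using ij by (simp add: g_def K_def e(1))
  qed
  ultimately have "card (oriented (grid_1d n r)) \<le> card K" by (rule card_inj_on_le) (simp add: K_def)
  then have "real (card (oriented (grid_1d n r))) \<le> real n * real (nat \<lfloor>r\<rfloor>)"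
    by (simp add: K_def card_cartesian_product flip: of_nat_mult)
  also have "\<dots> \<le> real n * r" using assms by (intro mult_left_mono) auto
  finally show ?thesis .
qed

text \<open>An edge is determined by its first node and an integer displacement with both entries at
  most r in modulus; 2 r + 1 \<le> 3 r for each entry gives the factor 9.\<close>

lemma card_oriented_grid_2d:
  assumes r: "1 \<le> r" and pos: "inj_on pos {1..n}"
  shows "real (card (oriented (grid_2d n pos r))) \<le> 9 * real n * r\<^sup>2"
proof -
  define W where "W = {- \<lfloor>r\<rfloor>..\<lfloor>r\<rfloor>}"
  define g where "g = (\<lambda>(i, j). (i, int (fst (pos i)) - int (fst (pos j)), int (snd (pos i)) - int (snd (pos j))))"
  define E where "E = oriented (grid_2d n pos r)"
  have E: "i \<in> {1..n} \<and> j \<in> {1..n} \<and>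
      \<bar>real (fst (pos i)) - real (fst (pos j))\<bar> + \<bar>real (snd (pos i)) - real (snd (pos j))\<bar> \<le> r"
    if "(i, j) \<in> E" for i j
    using that by (auto simp: E_def oriented_def grid_2d_def)
  have "inj_on g E"
  proof (rule inj_onI, clarify)
    fix i j i' j' assume *: "(i, j) \<in> E" "(i', j') \<in> E" "g (i, j) = g (i', j')"
    then have "i = i'" "pos j = pos j'" by (auto simp: g_def prod_eq_iff)
    then show "i = i' \<and> j = j'" using inj_onD[OF pos] E[OF *(1)] E[OF *(2)] by auto
  qed
  moreover have "g ` E \<subseteq> {1..n} \<times> W \<times> W"
  proof (rule image_subsetI)
    fix e assume "e \<in> E"
    then obtain i j where e: "e = (i, j)" and ij: "(i, j) \<in> E" by (cases e) auto
    have W: "a - b \<in> W" if "\<bar>real_of_int a - real_of_int b\<bar> \<le> r" for a b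
    proof -
      have "real_of_int (a - b) \<le> r" "real_of_int (b - a) \<le> r" using that by auto
      then have "a - b \<le> \<lfloor>r\<rfloor>" "b - a \<le> \<lfloor>r\<rfloor>" by (simp_all only: le_floor_iff)
      then show ?thesis by (simp add: W_def)
    qed
    have "int (fst (pos i)) - int (fst (pos j)) \<in> W" "int (snd (pos i)) - int (snd (pos j)) \<in> W"
      by (rule W; use E[OF ij] in simp; linarith)+
    then show "g e \<in> {1..n} \<times> W \<times> W" using E[OF ij] by (simp add: g_def e)
  qed
  ultimately have "card E \<le> card ({1..n} \<times> W \<times> W)" by (rule card_inj_on_le) (simp add: W_def)
  then have "real (card E) \<le> real (n * (card W * card W))"
    by (simp add: card_cartesian_product del: of_nat_mult)
  also have "\<dots> = real n * (real (card W))\<^sup>2" by (simp add: power2_eq_square)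
  also have "\<dots> \<le> real n * (3 * r)\<^sup>2"
  proof (intro mult_left_mono power_mono)
    have "real (card W) = 2 * real_of_int \<lfloor>r\<rfloor> + 1" using r by (simp add: W_def)
    then show "real (card W) \<le> 3 * r" using r by linarith
  qed auto
  finally show ?thesis by (simp add: E_def power_mult_distrib mult_ac)
qed

text \<open>Orientation doubles 84 to 168 and 192 to 384, the latter rounded up to 20^2 to have an
  exact root; then 8 * 20 = 160. With at most n r edges the condition on L requires 256 * 168^2 =
  7225344.\<close>

lemma mle_error_grid_1d:
  fixes \<delta> :: real
  assumes \<delta>: "0 < \<delta>" "\<delta> < 1 / 2" and model: "btl_model n (grid_1d n r) \<theta>s \<kappa> \<kappa>E" and rn: "r \<le> real n"
    and size: "8000000 * \<kappa>E ^ 5 * real n * ln (real n / \<delta>) \<le> r * real L"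
  shows "1 - \<delta> \<le> measure_pmf.prob (btl_samples (grid_1d n r) (\<lambda>_ _. L) \<theta>s)
    {y. mle_error_le n (grid_1d n r) (\<lambda>_ _. L) \<theta>s
      (160 * \<kappa>E * sqrt ((real n / r\<^sup>2 + 1) * (1 / (r * real L)) * ln (real n / \<delta>))) y}"
proof -
  define \<tau> where "\<tau> = ln (real n / \<delta>)"
  have conn: "connected_graph n (grid_1d n r)" and n: "1 \<le> n" and k1: "1 \<le> \<kappa>E"
    using model by (auto simp: btl_model_def connected_graph_def)
  have tau: "0 < \<tau>" using n \<delta> by (simp add: \<tau>_def)
  \<comment> \<open>As the logarithm is positive, the sample-size condition itself excludes L = 0
    and r \<le> 0.\<close>
  have "0 < 8000000 * \<kappa>E ^ 5 * real n * \<tau>" using k1 n tau by simp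
  also have "\<dots> \<le> r * real L" using size by (simp add: \<tau>_def)
  finally have rL: "0 < r * real L" .
  then have L: "1 \<le> L" and r0: "0 < r" by (auto simp: zero_less_mult_iff Suc_le_eq)
  show ?thesis
  proof (cases "n = 1")
    case True
    have B: "0 \<le> 160 * \<kappa>E * sqrt ((real n / r\<^sup>2 + 1) * (1 / (r * real L)) * ln (real n / \<delta>))"
      using k1 tau r0 by (simp add: \<tau>_def)
    show ?thesis using mle_error_probability_singleton[OF model[unfolded True] \<delta> L B] True by simp
  next
    case False
    then obtain i j where "(i, j) \<in> grid_1d n r" using connected_graph_edge[OF conn] n by auto
    then have r1: "1 \<le> r" by (auto simp: grid_1d_def)
    define x where "x = real n / r\<^sup>2 + 1"
    have x: "0 \<le> x" by (simp add: x_def)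
    show ?thesis
    proof (rule mle_error_probability[OF model \<delta> L, where Q = "168 / r" and R = "20\<^sup>2 * (x / r)"])
      show "has_resistance (oriented (grid_1d n r)) i j (168 / r)" if "(i, j) \<in> grid_1d n r" for i j
      proof -
        have "i \<in> {1..n}" "j \<in> {1..n}" using that by (auto simp: grid_1d_def)
        from oriented_grid_resistance[OF conn resistance_grid_1d(2)[OF r1 rn this that]]
        show ?thesis by simp
      qed
      show "has_resistance (oriented (grid_1d n r)) k l (20\<^sup>2 * (x / r))" if "k \<in> {1..n}" "l \<in> {1..n}" for k l
        using oriented_grid_resistance[OF conn resistance_grid_1d(1)[OF r1 rn that]]
        by (rule has_resistance_mono) (use x r0 in \<open>simp add: x_def[symmetric] divide_right_mono\<close>)
      have "256 * \<kappa>E ^ 4 * (168 / r)\<^sup>2 * real (card (oriented (grid_1d n r))) * \<tau> \<le>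
          256 * \<kappa>E ^ 4 * (168 / r)\<^sup>2 * (real n * r) * \<tau>"
        using card_oriented_grid_1d[OF r1, of n] k1 tau by (intro mult_right_mono mult_left_mono) auto
      also have "\<dots> = 7225344 * (\<kappa>E ^ 4 * real n * \<tau> / r)"
        using r0 by (simp add: power_divide power2_eq_square)
      also have "\<dots> \<le> 8000000 * (\<kappa>E ^ 4 * real n * \<tau> / r)"
        using k1 tau r0 by (intro mult_right_mono) auto
      also have "\<dots> = 8000000 * \<kappa>E ^ 4 * real n * \<tau> / r" by simp
      also have "\<dots> \<le> real L"
        by (rule sample_size_ge) (use k1 tau r0 size in \<open>auto simp: \<tau>_def\<close>)
      finally show "256 * \<kappa>E ^ 4 * (168 / r)\<^sup>2 * real (card (oriented (grid_1d n r))) * ln (real n / \<delta>) \<le> real L"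
        by (simp add: \<tau>_def)
      show "8 * \<kappa>E * sqrt (20\<^sup>2 * (x / r)) * sqrt (ln (real n / \<delta>) / real L) \<le>
          160 * \<kappa>E * sqrt ((real n / r\<^sup>2 + 1) * (1 / (r * real L)) * ln (real n / \<delta>))"
        unfolding x_def[symmetric] \<tau>_def[symmetric]
        by (rule error_bound_le) (use k1 x tau r0 in auto)
    qed (use r0 x in auto)
  qed
qed

text \<open>The constants are 2 * 4224 = 8448, 2 * 2000000 = 2000^2 and 8 * 2000 = 16000; with at
  most 9 n r^2 edges, the condition on L requires 256 * 8448^2 * 9 = 164433494016. In terms of the
  side m of the square, the bound on r reads r \<le> 2 m.\<close>

lemma mle_error_grid_2d:
  fixes \<delta> :: real
  assumes \<delta>: "0 < \<delta>" "\<delta> < 1 / 2" and enum: "grid_enumeration n pos"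
    and model: "btl_model n (grid_2d n pos r) \<theta>s \<kappa> \<kappa>E" and rn: "r \<le> 2 * sqrt (real n)"
    and size: "200000000000 * \<kappa>E ^ 5 * real n * ln (real n / \<delta>) \<le> r\<^sup>2 * real L"
  shows "1 - \<delta> \<le> measure_pmf.prob (btl_samples (grid_2d n pos r) (\<lambda>_ _. L) \<theta>s)
    {y. mle_error_le n (grid_2d n pos r) (\<lambda>_ _. L) \<theta>s
      (16000 * \<kappa>E * sqrt ((ln (real n) / r\<^sup>2 + 1) * (1 / (r\<^sup>2 * real L)) * ln (real n / \<delta>))) y}"
proof -
  define \<tau> where "\<tau> = ln (real n / \<delta>)"
  obtain m where m: "n = m\<^sup>2" and bij: "bij_betw pos {1..n} ({1..m} \<times> {1..m})"
    using enum by (auto simp: grid_enumeration_def)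
  have mem: "pos i \<in> {1..m} \<times> {1..m}" if "i \<in> {1..n}" for i using bij_betwE[OF bij] that by blast
  have conn: "connected_graph n (grid_2d n pos r)" and n: "1 \<le> n" and k1: "1 \<le> \<kappa>E"
    using model by (auto simp: btl_model_def connected_graph_def)
  have tau: "0 < \<tau>" using n \<delta> by (simp add: \<tau>_def)
  have "0 < 200000000000 * \<kappa>E ^ 5 * real n * \<tau>" using k1 n tau by simp
  also have "\<dots> \<le> r\<^sup>2 * real L" using size by (simp add: \<tau>_def)
  finally have rL: "0 < r\<^sup>2 * real L" .
  then have L: "1 \<le> L" and r2: "0 < r\<^sup>2" by (auto simp: zero_less_mult_iff Suc_le_eq)
  define x where "x = ln (real n) / r\<^sup>2 + 1"
  have x: "0 \<le> x" using n by (simp add: x_def)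
  show ?thesis
  proof (cases "n = 1")
    case True
    have B: "0 \<le> 16000 * \<kappa>E * sqrt ((ln (real n) / r\<^sup>2 + 1) * (1 / (r\<^sup>2 * real L)) * ln (real n / \<delta>))"
      using k1 tau x by (simp add: \<tau>_def x_def)
    show ?thesis using mle_error_probability_singleton[OF model[unfolded True] \<delta> L B] True by simp
  next
    case False
    then obtain i j where ij: "(i, j) \<in> grid_2d n pos r" using connected_graph_edge[OF conn] n by auto
    have r1: "1 \<le> r"
    proof -
      have "pos i \<noteq> pos j" using ij inj_onD[OF bij_betw_imp_inj_on[OF bij], of i j] by (auto simp: grid_2d_def)
      then have "fst (pos i) \<noteq> fst (pos j) \<or> snd (pos i) \<noteq> snd (pos j)" by (auto simp: prod_eq_iff)
      then have "1 \<le> \<bar>real (fst (pos i)) - real (fst (pos j))\<bar> + \<bar>real (snd (pos i)) - real (snd (pos j))\<bar>"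
        by linarith
      then show ?thesis using ij by (simp add: grid_2d_def)
    qed
    have rm: "r \<le> 2 * real m" using rn by (simp add: m)
    note bound = resistance_ball_2d_bounds[OF r1 rm mem mem]
    show ?thesis
    proof (rule mle_error_probability[OF model \<delta> L, where Q = "8448 / r\<^sup>2" and R = "2000\<^sup>2 * (x / r\<^sup>2)"])
      show "has_resistance (oriented (grid_2d n pos r)) i j (8448 / r\<^sup>2)" if e: "(i, j) \<in> grid_2d n pos r" for i j
      proof -
        have ij: "i \<in> {1..n}" "j \<in> {1..n}" using e by (auto simp: grid_2d_def)
        then have "(pos i, pos j) \<in> ball_2d m r"
          using e mem[OF ij(1)] mem[OF ij(2)] by (simp add: grid_2d_def ball_2d_def)
        from oriented_grid_resistance[OF conn has_resistance_grid_2d[OF bij ij bound(2)[OF ij this]]]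
        show ?thesis by simp
      qed
      show "has_resistance (oriented (grid_2d n pos r)) k l (2000\<^sup>2 * (x / r\<^sup>2))"
        if "k \<in> {1..n}" "l \<in> {1..n}" for k l
        using oriented_grid_resistance[OF conn has_resistance_grid_2d[OF bij that bound(1)[OF that]]]
        by (simp add: x_def m)
      have "256 * \<kappa>E ^ 4 * (8448 / r\<^sup>2)\<^sup>2 * real (card (oriented (grid_2d n pos r))) * \<tau> \<le>
          256 * \<kappa>E ^ 4 * (8448 / r\<^sup>2)\<^sup>2 * (9 * real n * r\<^sup>2) * \<tau>"
        using card_oriented_grid_2d[OF r1 bij_betw_imp_inj_on[OF bij]] k1 tau
        by (intro mult_right_mono mult_left_mono) auto
      also have "\<dots> = 164433494016 * (\<kappa>E ^ 4 * real n * \<tau> / r\<^sup>2)"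
        using r2 by (simp add: power_divide power2_eq_square)
      also have "\<dots> \<le> 200000000000 * (\<kappa>E ^ 4 * real n * \<tau> / r\<^sup>2)"
        using k1 tau r2 by (intro mult_right_mono) auto
      also have "\<dots> = 200000000000 * \<kappa>E ^ 4 * real n * \<tau> / r\<^sup>2" by simp
      also have "\<dots> \<le> real L"
        by (rule sample_size_ge) (use k1 tau r2 size in \<open>auto simp: \<tau>_def\<close>)
      finally show "256 * \<kappa>E ^ 4 * (8448 / r\<^sup>2)\<^sup>2 * real (card (oriented (grid_2d n pos r))) * ln (real n / \<delta>) \<le> real L"
        by (simp add: \<tau>_def)
      show "8 * \<kappa>E * sqrt (2000\<^sup>2 * (x / r\<^sup>2)) * sqrt (ln (real n / \<delta>) / real L) \<le>
          16000 * \<kappa>E * sqrt ((ln (real n) / r\<^sup>2 + 1) * (1 / (r\<^sup>2 * real L)) * ln (real n / \<delta>))"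
        unfolding x_def[symmetric] \<tau>_def[symmetric]
        by (rule error_bound_le) (use k1 x tau r2 in auto)
    qed (use r2 x in auto)
  qed
qed

(* The bounds r <= n and r <= 2 * sqrt n lose no grid: beyond them the graph is complete and no
   longer changes, while the sample-size condition and the error bound would still improve with r. *)
theorem corollary1:
  "\<exists>C C'. 0 < C \<and> 0 < C' \<and>
     (\<forall>(n::nat) (r::real) (L::nat) (\<theta>s::nat \<Rightarrow> real) (\<kappa>::real) (\<kappa>E::real) (\<delta>::real).
        0 < \<delta> \<and> \<delta> < 1 / 2 \<longrightarrow>
        (btl_model n (grid_1d n r) \<theta>s \<kappa> \<kappa>E \<and> r \<le> real n \<and>
         r * real L \<ge> C * \<kappa>E ^ 5 * real n * ln (real n / \<delta>) \<longrightarrow>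
           measure_pmf.prob (btl_samples (grid_1d n r) (\<lambda>_ _. L) \<theta>s)
             {y. mle_error_le n (grid_1d n r) (\<lambda>_ _. L) \<theta>s
                   (C' * \<kappa>E * sqrt ((real n / r\<^sup>2 + 1) * (1 / (r * real L)) * ln (real n / \<delta>))) y}
           \<ge> 1 - \<delta>) \<and>
        (\<forall>pos :: nat \<Rightarrow> nat \<times> nat.
         grid_enumeration n pos \<and>
         btl_model n (grid_2d n pos r) \<theta>s \<kappa> \<kappa>E \<and> r \<le> 2 * sqrt (real n) \<and>
         r\<^sup>2 * real L \<ge> C * \<kappa>E ^ 5 * real n * ln (real n / \<delta>) \<longrightarrow>
           measure_pmf.prob (btl_samples (grid_2d n pos r) (\<lambda>_ _. L) \<theta>s)
             {y. mle_error_le n (grid_2d n pos r) (\<lambda>_ _. L) \<theta>s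
                   (C' * \<kappa>E * sqrt ((ln (real n) / r\<^sup>2 + 1) * (1 / (r\<^sup>2 * real L)) * ln (real n / \<delta>))) y}
           \<ge> 1 - \<delta>))"
proof -
  \<comment> \<open>Both constants are those of the two-dimensional grid. They exceed the ones of
    the one-dimensional grid, whose smaller error bound is relaxed by \<open>mono\<close>.\<close>
  define C :: real where "C = 200000000000"
  define C' :: real where "C' = 16000"
  have mono: "mle_error_le n E L \<theta>s b y \<Longrightarrow> b \<le> b' \<Longrightarrow> mle_error_le n E L \<theta>s b' y" for n E L \<theta>s b b' y
    unfolding mle_error_le_def by (meson order_trans)
  have d1: "1 - \<delta> \<le> measure_pmf.prob (btl_samples (grid_1d n r) (\<lambda>_ _. L) \<theta>s)
      {y. mle_error_le n (grid_1d n r) (\<lambda>_ _. L) \<theta>s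
        (C' * \<kappa>E * sqrt ((real n / r\<^sup>2 + 1) * (1 / (r * real L)) * ln (real n / \<delta>))) y}"
    if \<delta>: "0 < \<delta>" "\<delta> < 1 / 2" and model: "btl_model n (grid_1d n r) \<theta>s \<kappa> \<kappa>E" and rn: "r \<le> real n"
      and size: "C * \<kappa>E ^ 5 * real n * ln (real n / \<delta>) \<le> r * real L" for n r \<theta>s \<kappa> \<kappa>E \<delta> and L :: nat
  proof -
    have n: "1 \<le> n" and k1: "1 \<le> \<kappa>E" using model by (auto simp: btl_model_def connected_graph_def)
    then have tau: "0 \<le> ln (real n / \<delta>)" using \<delta> by simp
    have z: "0 \<le> \<kappa>E ^ 5 * real n * ln (real n / \<delta>)" using k1 tau by simp
    then have size': "8000000 * \<kappa>E ^ 5 * real n * ln (real n / \<delta>) \<le> r * real L"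
      using size by (simp add: C_def mult.assoc)
    have rL: "0 \<le> r * real L" using z size by (simp add: C_def mult.assoc)
    have "160 * \<kappa>E * sqrt ((real n / r\<^sup>2 + 1) * (1 / (r * real L)) * ln (real n / \<delta>)) \<le>
        C' * \<kappa>E * sqrt ((real n / r\<^sup>2 + 1) * (1 / (r * real L)) * ln (real n / \<delta>))"
      using k1 tau rL by (intro mult_right_mono) (auto simp: C'_def)
    then show ?thesis
      by (intro order_trans[OF mle_error_grid_1d[OF \<delta> model rn size']] measure_pmf.finite_measure_mono)
         (auto intro: mono)
  qed
  have d2: "1 - \<delta> \<le> measure_pmf.prob (btl_samples (grid_2d n pos r) (\<lambda>_ _. L) \<theta>s)
      {y. mle_error_le n (grid_2d n pos r) (\<lambda>_ _. L) \<theta>s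
        (C' * \<kappa>E * sqrt ((ln (real n) / r\<^sup>2 + 1) * (1 / (r\<^sup>2 * real L)) * ln (real n / \<delta>))) y}"
    if "0 < \<delta>" "\<delta> < 1 / 2" "grid_enumeration n pos" "btl_model n (grid_2d n pos r) \<theta>s \<kappa> \<kappa>E"
      "r \<le> 2 * sqrt (real n)" "C * \<kappa>E ^ 5 * real n * ln (real n / \<delta>) \<le> r\<^sup>2 * real L"
    for n r \<theta>s \<kappa> \<kappa>E \<delta> pos and L :: nat
    using mle_error_grid_2d[OF that[unfolded C_def]] by (simp add: C'_def)
  show ?thesis
    by (rule exI[of _ C], rule exI[of _ C']) (use d1 d2 in \<open>auto simp: C_def C'_def\<close>)
qed

end
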